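(* Consider an asymptotic regime indexed by $n\to\infty$ with $p=p_n>n$, and the linear model $Y=X\beta_0+\epsilon$, where $X=(X_1,\dots,X_p)\in\mathbb{R}^{n\times p}$ is a random design with zero mean and positive definite $\Sigma=E[X^TX/n]$, $\beta_0\in\mathbb{R}^p$ has $s_0$ nonzero entries, and $\epsilon\sim N(0,\sigma_\epsilon^2I_n)$ is independent of $X$. Assume: (A1) (general position) with probability one, for any $k<\min\{n,p\}$, any indices $i_1,\dots,i_{k+1}$ and signs $\sigma_1,\dots,\sigma_{k+1}\in\{-1,1\}$, the affine span of $\sigma_1X_{i_1},\dots,\sigma_{k+1}X_{i_{k+1}}$ contains no element of $\{\pm X_i:i\ne i_1,\dots,i_{k+1}\}$; (A2) there are positive constants $C_{\min}$, $K$ (with $n$ divisible by $K$) such that $P(\phi_{\min}(n/K)\ge C_{\min})\to1$; (A3) there is a positive constant $C_{\max}$ with $P(\phi_{\max}(n)\le C_{\max})\to1$; (A4) (i) there is a positive constant $C^*$ with $P(\phi_{\max}(1)>C^* )=O(1/p)$; (ii) there is a positive constant $\kappa_{\min}$ with $P(\kappa(s_0,3)^2\ge\kappa_{\min}^2)\to1$. Suppose $s_0=o(\sqrt{n/\log p})$. Then for suitably selected $\lambda_0\asymp\sqrt{\log p/n}$ and $\lambda_1\asymp1/\sqrt n$, $$\sqrt n(\hat b_1-\beta_{01})=W_1+\Delta_1,$$ where $W_1=\frac1{\sqrt n}\hat\Theta_1^TX^T\epsilon$ satisfies $W_1\mid X\sim N(0,\sigma_\epsilon^2\hat\Omega_{1,1})$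 with $\hat\Omega_{1,1}:=\hat\Theta_1^T\hat\Sigma\hat\Theta_1=O_P(1)$, and $\Delta_1:=\sqrt n(\hat\Sigma\hat\Theta_1-e_1)^T(\beta_0-\hat\beta)=o_P(1)$.
   Context: $\hat\Sigma=X^TX/n$; $e_1$ is the first standard basis vector; $\beta_{01}$ is the first entry of $\beta_0$. $a_n\asymp b_n$ means $C_1\le a_n/b_n\le C_2$ for positive constants $C_1,C_2$. Restricted eigenvalues: $\phi_{\max}(s)=\max_{1\le\|z\|_0\le s}\frac{\|Xz\|^2}{n\|z\|^2}$, $\phi_{\min}(s)=\min_{1\le\|z\|_0\le s}\frac{\|Xz\|^2}{n\|z\|^2}$, and $\kappa(s,c_0)^2=\min_{S\subset\{1,\dots,p\},|S|\le s}\ \min_{z\ne0,\ \|z_{S^c}\|_1\le c_0\|z_S\|_1}\frac{\|Xz\|^2}{n\|z_S\|^2}$. Lasso: $\hat\beta=\arg\min_\beta\frac1n\|Y-X\beta\|^2+2\lambda_0\|\beta\|_1$. Node-wise Lasso: $\hat\gamma_1=\arg\min_{\gamma\in\mathbb{R}^{p-1}}\frac1n\|X_1-X_{-1}\gamma\|^2+2\lambda_1\|\gamma\|_1$ ($X_{-1}$ is $X$ without its first column), $\tilde\tau_1^2=\frac1n\|X_1-X_{-1}\hat\gamma_1\|^2$, $\hat\tau_1^2=\tilde\tau_1^2+\lambda_1\|\hat\gamma_1\|_1$, $\hat\Theta_1=\hat\tau_1^{-2}(1,-\hat\gamma_1^T)^T$. Debiased Lasso: $\hat b_1=\hat\beta_1+\frac1n\hat\Theta_1^TX^T(Y-X\hat\beta)$.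 *)

theory Defs
  imports "HOL-Probability.Probability" "HOL-Library.Landau_Symbols"
begin

text \<open>Conventions. A vector in R^p is a function nat => real vanishing at indices >= p;
an n x p matrix is a function nat => nat => real (row i < n, column j < p).
Indices start at 0, so the paper's first column / first coordinate is index 0.\<close>

definition mv :: "nat \<Rightarrow> (nat \<Rightarrow> nat \<Rightarrow> real) \<Rightarrow> (nat \<Rightarrow> real) \<Rightarrow> nat \<Rightarrow> real" where
  "mv p X z = (\<lambda>i. \<Sum>j<p. X i j * z j)"

definition sqn :: "nat \<Rightarrow> (nat \<Rightarrow> real) \<Rightarrow> real" where
  "sqn n v = (\<Sum>i<n. (v i)^2)"

definition l0norm :: "nat \<Rightarrow> (nat \<Rightarrow> real) \<Rightarrow> nat" where
  "l0norm p z = card {j. j < p \<and> z j \<noteq> 0}"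

definition phi_max :: "nat \<Rightarrow> nat \<Rightarrow> (nat \<Rightarrow> nat \<Rightarrow> real) \<Rightarrow> nat \<Rightarrow> real" where
  "phi_max n p X s = Sup {sqn n (mv p X z) / (real n * (\<Sum>j<p. (z j)^2)) | z.
      (\<forall>j\<ge>p. z j = 0) \<and> 1 \<le> l0norm p z \<and> l0norm p z \<le> s}"

definition phi_min :: "nat \<Rightarrow> nat \<Rightarrow> (nat \<Rightarrow> nat \<Rightarrow> real) \<Rightarrow> nat \<Rightarrow> real" where
  "phi_min n p X s = Inf {sqn n (mv p X z) / (real n * (\<Sum>j<p. (z j)^2)) | z.
      (\<forall>j\<ge>p. z j = 0) \<and> 1 \<le> l0norm p z \<and> l0norm p z \<le> s}"

definition kappa_sq :: "nat \<Rightarrow> nat \<Rightarrow> (nat \<Rightarrow> nat \<Rightarrow> real) \<Rightarrow> nat \<Rightarrow> real \<Rightarrow> real" where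
  "kappa_sq n p X s c0 = Inf {sqn n (mv p X z) / (real n * (\<Sum>j\<in>S. (z j)^2)) | S z.
      S \<subseteq> {..<p} \<and> card S \<le> s \<and> (\<forall>j\<ge>p. z j = 0) \<and> (\<exists>j<p. z j \<noteq> 0) \<and>
      (\<Sum>j\<in>{..<p} - S. \<bar>z j\<bar>) \<le> c0 * (\<Sum>j\<in>S. \<bar>z j\<bar>)}"

definition general_position :: "nat \<Rightarrow> nat \<Rightarrow> (nat \<Rightarrow> nat \<Rightarrow> real) \<Rightarrow> bool" where
  "general_position n p X \<longleftrightarrow>
     (\<forall>S sg. S \<subseteq> {..<p} \<and> 1 \<le> card S \<and> card S \<le> min n p \<and> (\<forall>j\<in>S. sg j \<in> {-1, 1::real}) \<longrightarrow>
        \<not> (\<exists>c l t. l < p \<and> l \<notin> S \<and> t \<in> {-1, 1::real} \<and> (\<Sum>j\<in>S. c j) = 1 \<and>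
              (\<forall>i<n. (\<Sum>j\<in>S. c j * (sg j * X i j)) = t * X i l)))"

definition lasso_obj :: "nat \<Rightarrow> nat \<Rightarrow> (nat \<Rightarrow> nat \<Rightarrow> real) \<Rightarrow> (nat \<Rightarrow> real) \<Rightarrow> real \<Rightarrow> (nat \<Rightarrow> real) \<Rightarrow> real" where
  "lasso_obj n p X Y lam b = sqn n (\<lambda>i. Y i - mv p X b i) / real n + 2 * lam * (\<Sum>j<p. \<bar>b j\<bar>)"

definition lasso :: "nat \<Rightarrow> nat \<Rightarrow> (nat \<Rightarrow> nat \<Rightarrow> real) \<Rightarrow> (nat \<Rightarrow> real) \<Rightarrow> real \<Rightarrow> nat \<Rightarrow> real" where
  "lasso n p X Y lam = (SOME b. (\<forall>j\<ge>p. b j = 0) \<and>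
      (\<forall>b'. (\<forall>j\<ge>p. b' j = 0) \<longrightarrow> lasso_obj n p X Y lam b \<le> lasso_obj n p X Y lam b'))"

definition node_obj :: "nat \<Rightarrow> nat \<Rightarrow> (nat \<Rightarrow> nat \<Rightarrow> real) \<Rightarrow> real \<Rightarrow> (nat \<Rightarrow> real) \<Rightarrow> real" where
  "node_obj n p X lam g = sqn n (\<lambda>i. X i 0 - (\<Sum>j\<in>{1..<p}. X i j * g j)) / real n
      + 2 * lam * (\<Sum>j\<in>{1..<p}. \<bar>g j\<bar>)"

definition gamma_hat :: "nat \<Rightarrow> nat \<Rightarrow> (nat \<Rightarrow> nat \<Rightarrow> real) \<Rightarrow> real \<Rightarrow> nat \<Rightarrow> real" where
  "gamma_hat n p X lam = (SOME g. (\<forall>j. j = 0 \<or> p \<le> j \<longrightarrow> g j = 0) \<and>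
      (\<forall>g'. (\<forall>j. j = 0 \<or> p \<le> j \<longrightarrow> g' j = 0) \<longrightarrow> node_obj n p X lam g \<le> node_obj n p X lam g'))"

definition tau_tilde_sq :: "nat \<Rightarrow> nat \<Rightarrow> (nat \<Rightarrow> nat \<Rightarrow> real) \<Rightarrow> real \<Rightarrow> real" where
  "tau_tilde_sq n p X lam =
     sqn n (\<lambda>i. X i 0 - (\<Sum>j\<in>{1..<p}. X i j * gamma_hat n p X lam j)) / real n"

definition tau_hat_sq :: "nat \<Rightarrow> nat \<Rightarrow> (nat \<Rightarrow> nat \<Rightarrow> real) \<Rightarrow> real \<Rightarrow> real" where
  "tau_hat_sq n p X lam = tau_tilde_sq n p X lam + lam * (\<Sum>j\<in>{1..<p}. \<bar>gamma_hat n p X lam j\<bar>)"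

definition Theta_hat :: "nat \<Rightarrow> nat \<Rightarrow> (nat \<Rightarrow> nat \<Rightarrow> real) \<Rightarrow> real \<Rightarrow> nat \<Rightarrow> real" where
  "Theta_hat n p X lam = (\<lambda>j. (if j = 0 then 1 else - gamma_hat n p X lam j) / tau_hat_sq n p X lam)"

definition Sigma_hat :: "nat \<Rightarrow> (nat \<Rightarrow> nat \<Rightarrow> real) \<Rightarrow> nat \<Rightarrow> nat \<Rightarrow> real" where
  "Sigma_hat n X j l = (\<Sum>i<n. X i j * X i l) / real n"

definition debiased1 :: "nat \<Rightarrow> nat \<Rightarrow> (nat \<Rightarrow> nat \<Rightarrow> real) \<Rightarrow> (nat \<Rightarrow> real) \<Rightarrow> real \<Rightarrow> real \<Rightarrow> real" where
  "debiased1 n p X Y lam0 lam1 =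
     lasso n p X Y lam0 0 + (\<Sum>j<p. Theta_hat n p X lam1 j *
        (\<Sum>i<n. X i j * (Y i - mv p X (lasso n p X Y lam0) i))) / real n"

definition W1 :: "nat \<Rightarrow> nat \<Rightarrow> (nat \<Rightarrow> nat \<Rightarrow> real) \<Rightarrow> (nat \<Rightarrow> real) \<Rightarrow> real \<Rightarrow> real" where
  "W1 n p X eps lam1 = (\<Sum>j<p. Theta_hat n p X lam1 j * (\<Sum>i<n. X i j * eps i)) / sqrt (real n)"

definition Omega_hat :: "nat \<Rightarrow> nat \<Rightarrow> (nat \<Rightarrow> nat \<Rightarrow> real) \<Rightarrow> real \<Rightarrow> real" where
  "Omega_hat n p X lam1 = (\<Sum>j<p. \<Sum>l<p.
      Theta_hat n p X lam1 j * Sigma_hat n X j l * Theta_hat n p X lam1 l)"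

definition Delta1 :: "nat \<Rightarrow> nat \<Rightarrow> (nat \<Rightarrow> nat \<Rightarrow> real) \<Rightarrow> (nat \<Rightarrow> real) \<Rightarrow> (nat \<Rightarrow> real) \<Rightarrow> real \<Rightarrow> real \<Rightarrow> real" where
  "Delta1 n p X Y beta0 lam0 lam1 = sqrt (real n) * (\<Sum>j<p.
      ((\<Sum>l<p. Sigma_hat n X j l * Theta_hat n p X lam1 l) - (if j = 0 then 1 else 0)) *
      (beta0 j - lasso n p X Y lam0 j))"

definition matM :: "(nat \<Rightarrow> nat \<Rightarrow> real) measure" where
  "matM = PiM UNIV (\<lambda>_. PiM UNIV (\<lambda>_. (borel :: real measure)))"

definition normal_law :: "real \<Rightarrow> real measure" where
  "normal_law v = (if v \<le> 0 then return borel 0 else density lborel (normal_density 0 (sqrt v)))"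

text \<open>Probability statements along the sequence of experiments M k. Events are
  handled through measurable sub-events (inner probability), so that no statement
  becomes vacuous through non-measurability.\<close>
definition whp :: "(nat \<Rightarrow> 'a measure) \<Rightarrow> (nat \<Rightarrow> 'a \<Rightarrow> bool) \<Rightarrow> bool" where
  "whp M P \<longleftrightarrow> (\<forall>e>0. \<forall>\<^sub>F k in sequentially.
      \<exists>E\<in>sets (M k). E \<subseteq> {\<omega>\<in>space (M k). P k \<omega>} \<and> measure (M k) E \<ge> 1 - e)"

definition bounded_in_prob :: "(nat \<Rightarrow> 'a measure) \<Rightarrow> (nat \<Rightarrow> 'a \<Rightarrow> real) \<Rightarrow> bool" where
  "bounded_in_prob M Z \<longleftrightarrow> (\<forall>e>0. \<exists>C. \<forall>\<^sub>F k in sequentially.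
      \<exists>E\<in>sets (M k). E \<subseteq> {\<omega>\<in>space (M k). \<bar>Z k \<omega>\<bar> \<le> C} \<and> measure (M k) E \<ge> 1 - e)"

definition small_in_prob :: "(nat \<Rightarrow> 'a measure) \<Rightarrow> (nat \<Rightarrow> 'a \<Rightarrow> real) \<Rightarrow> bool" where
  "small_in_prob M Z \<longleftrightarrow> (\<forall>\<delta>>0. whp M (\<lambda>k \<omega>. \<bar>Z k \<omega>\<bar> \<le> \<delta>))"

end

theory Submission
  imports Defs
begin

text \<open>The node-wise residual \<open>r\<close> satisfies \<open>X\<^sub>0\<^sup>T r / n = \<tau>\<^sup>2\<close> (the hatted one) and \<open>|X\<^sub>j\<^sup>T r / n| \<le> \<lambda>\<^sub>1\<close>
  for the other columns, so \<open>|\<Delta>\<^sub>1| \<le> \<surd>n (\<lambda>\<^sub>1 / \<tau>\<^sup>2)\<close> times the l1 error of the Lasso, which is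
  \<open>O(s\<^sub>0 \<lambda>\<^sub>0)\<close> by the usual cone argument. For \<open>\<lambda>\<^sub>1 = c / \<surd>n\<close> with \<open>c\<close> large, the upper sparse
  eigenvalue forces the node-wise Lasso to have fewer than \<open>n / K\<close> active coordinates, and then the
  lower sparse eigenvalue keeps \<open>\<tau>\<^sup>2\<close> away from zero.

  \<open>W\<^sub>1\<close> and the variance depend on the node-wise coefficients only through \<open>r\<close>, because
  \<open>\<tau>\<^sup>2 = X\<^sub>0\<^sup>T r / n\<close>. The residual is unique and a measurable function of the design even
  where the coefficients are neither.\<close>

section \<open>l1-penalised least squares\<close>

text \<open>The rate of \<open>lam1\<close> shapes the argument. The bound on \<open>Delta1\<close>
  carries the factor \<open>sqrt n * lam1\<close>, and the l1 error of the Lasso is of order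
  \<open>s0 * sqrt (ln p / n)\<close>. With \<open>lam1\<close> of order \<open>1 / sqrt n\<close>
  the factor stays constant, and the sparsity assumption makes the product vanish. The price is a
  penalty below the usual level \<open>sqrt (ln p / n)\<close>. No sparsity of a population
  regression vector is assumed either, so the support of the node-wise Lasso has to be counted from
  its optimality conditions alone. This looks circular: the upper sparse eigenvalue speaks only of
  at most \<open>n\<close> columns, and the support might be larger. The count is therefore made for
  subsets of the support, and a support of more than \<open>n\<close> elements is excluded by one of
  its subsets of exactly \<open>n\<close> elements.

  The eigenvalue conditions hold on events known only through measurable sub-events. The noise event
  is thus phrased as an implication from a bound on the column norms; its complement is measurable,
  and Fubini's theorem carries the Gaussian tail at a fixed design over to it.\<close>

definition l1_obj :: "nat \<Rightarrow> nat set \<Rightarrow> (nat \<Rightarrow> nat \<Rightarrow> real) \<Rightarrow> (nat \<Rightarrow> real) \<Rightarrow> real \<Rightarrow> (nat \<Rightarrow> real) \<Rightarrow> real" where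
  "l1_obj n J X Y lam b =
     sqn n (\<lambda>i. Y i - (\<Sum>j\<in>J. X i j * b j)) / real n + 2 * lam * (\<Sum>j\<in>J. \<bar>b j\<bar>)"

text \<open>A predicate, so that its consequences hold for whichever minimiser the choice operators
  in \<open>lasso\<close> and \<open>gamma_hat\<close> pick. The index sets \<open>{..<p}\<close>
  and \<open>{1..<p}\<close> cover the two estimators.\<close>

definition l1_min :: "nat \<Rightarrow> nat set \<Rightarrow> (nat \<Rightarrow> nat \<Rightarrow> real) \<Rightarrow> (nat \<Rightarrow> real) \<Rightarrow> real \<Rightarrow> (nat \<Rightarrow> real) \<Rightarrow> bool" where
  "l1_min n J X Y lam b \<longleftrightarrow> (\<forall>j. j \<notin> J \<longrightarrow> b j = 0) \<and>
     (\<forall>b'. (\<forall>j. j \<notin> J \<longrightarrow> b' j = 0) \<longrightarrow> l1_obj n J X Y lam b \<le> l1_obj n J X Y lam b')"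

lemma sqn_nonneg [simp]: "0 \<le> sqn n v"
  by (simp add: sqn_def sum_nonneg)

lemma l1_obj_cong: "(\<And>j. j \<in> J \<Longrightarrow> b j = b' j) \<Longrightarrow> l1_obj n J X Y lam b = l1_obj n J X Y lam b'"
  by (simp add: l1_obj_def cong: sum.cong)

lemma l1_min_le:
  assumes "l1_min n J X Y lam b"
  shows "l1_obj n J X Y lam b \<le> l1_obj n J X Y lam b'"
proof -
  have "l1_obj n J X Y lam b \<le> l1_obj n J X Y lam (\<lambda>j. if j \<in> J then b' j else 0)"
    using assms by (simp add: l1_min_def)
  also have "\<dots> = l1_obj n J X Y lam b'"
    by (rule l1_obj_cong) simp
  finally show ?thesis .
qed

text \<open>Outside the box of radius \<open>R\<close> the penalty alone exceeds the objective at 0,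
  so a minimiser over the box is global. The box is compact in the product topology by Tychonoff;
  coordinates outside \<open>J\<close> get the one-point factor \<open>{0}\<close>.\<close>

lemma l1_min_exists:
  assumes J: "finite J" and lam: "0 < lam"
  shows "\<exists>b. l1_min n J X Y lam b"
proof -
  define R where "R = l1_obj n J X Y lam (\<lambda>_. 0) / (2 * lam)"
  define T where "T j = (if j \<in> J then {-R..R} else {0::real})" for j
  have R0: "0 \<le> R"
    using lam by (simp add: R_def l1_obj_def)
  have "compactin (product_topology (\<lambda>i. euclidean) UNIV) (PiE UNIV T)"
    unfolding compactin_PiE by (auto simp: T_def)
  then have "compact (PiE UNIV T)"
    by (simp add: euclidean_product_topology)
  moreover have "(\<lambda>_. 0) \<in> PiE UNIV T"
    using R0 by (auto simp: T_def)
  moreover have "continuous_on (PiE UNIV T) (l1_obj n J X Y lam)"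
    unfolding l1_obj_def[abs_def] sqn_def divide_inverse
    by (intro continuous_intros continuous_on_const
        continuous_on_subset[OF continuous_on_product_coordinates]) auto
  ultimately obtain b where b: "b \<in> PiE UNIV T"
      and bmin: "\<And>b'. b' \<in> PiE UNIV T \<Longrightarrow> l1_obj n J X Y lam b \<le> l1_obj n J X Y lam b'"
    using continuous_attains_inf[of "PiE UNIV T" "l1_obj n J X Y lam"] by blast
  have bT: "b j \<in> T j" for j
    using b by auto
  have "l1_obj n J X Y lam b \<le> l1_obj n J X Y lam b'" if b': "\<forall>j. j \<notin> J \<longrightarrow> b' j = 0" for b'
  proof (cases "b' \<in> PiE UNIV T")
    case True
    then show ?thesis by (rule bmin)
  next
    case False
    then obtain j where "b' j \<notin> T j" by auto
    then have j: "j \<in> J" "R < \<bar>b' j\<bar>"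
      using b' by (auto simp: T_def split: if_splits)
    have "\<bar>b' j\<bar> \<le> (\<Sum>j\<in>J. \<bar>b' j\<bar>)"
      using J j by (intro member_le_sum) auto
    then have "R < (\<Sum>j\<in>J. \<bar>b' j\<bar>)" using j by simp
    then have "l1_obj n J X Y lam (\<lambda>_. 0) < 2 * lam * (\<Sum>j\<in>J. \<bar>b' j\<bar>)"
      using lam by (simp add: R_def field_simps)
    also have "\<dots> \<le> l1_obj n J X Y lam b'"
      by (simp add: l1_obj_def)
    finally show ?thesis
      using bmin[OF \<open>(\<lambda>_. 0) \<in> PiE UNIV T\<close>] by simp
  qed
  moreover have "b j = 0" if "j \<notin> J" for j
    using bT[of j] that by (simp add: T_def)
  ultimately show ?thesis
    unfolding l1_min_def by blast
qed

section \<open>Optimality conditions, one coordinate at a time\<close>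

text \<open>Minus half the partial derivative of the least-squares term.\<close>

definition score :: "nat \<Rightarrow> nat set \<Rightarrow> (nat \<Rightarrow> nat \<Rightarrow> real) \<Rightarrow> (nat \<Rightarrow> real) \<Rightarrow> (nat \<Rightarrow> real) \<Rightarrow> nat \<Rightarrow> real" where
  "score n J X Y b j = (\<Sum>i<n. X i j * (Y i - (\<Sum>k\<in>J. X i k * b k))) / real n"

text \<open>With this exact expansion the optimality conditions become elementary inequalities in
  \<open>t\<close>, without subdifferentials.\<close>

lemma l1_obj_coordinate_shift:
  assumes J: "finite J" "j \<in> J"
  shows "l1_obj n J X Y lam (b(j := b j + t)) = l1_obj n J X Y lam b - 2 * t * score n J X Y b j
    + t^2 * (sqn n (\<lambda>i. X i j) / real n) + 2 * lam * (\<bar>b j + t\<bar> - \<bar>b j\<bar>)"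
proof -
  let ?r = "\<lambda>i. Y i - (\<Sum>k\<in>J. X i k * b k)"
  have res: "Y i - (\<Sum>k\<in>J. X i k * (b(j := b j + t)) k) = ?r i - t * X i j" for i
  proof -
    have "(\<Sum>k\<in>J. X i k * (b(j := b j + t)) k) = X i j * (b j + t) + (\<Sum>k\<in>J-{j}. X i k * b k)"
      by (subst sum.remove[OF J]) (auto intro!: sum.cong)
    moreover have "(\<Sum>k\<in>J. X i k * b k) = X i j * b j + (\<Sum>k\<in>J-{j}. X i k * b k)"
      by (rule sum.remove[OF J])
    ultimately show ?thesis by (simp add: algebra_simps)
  qed
  have "(\<Sum>k\<in>J. \<bar>(b(j := b j + t)) k\<bar>) = \<bar>b j + t\<bar> + (\<Sum>k\<in>J-{j}. \<bar>b k\<bar>)"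
    by (subst sum.remove[OF J]) (auto intro!: sum.cong)
  moreover have "(\<Sum>k\<in>J. \<bar>b k\<bar>) = \<bar>b j\<bar> + (\<Sum>k\<in>J-{j}. \<bar>b k\<bar>)"
    by (rule sum.remove[OF J])
  ultimately have l1: "(\<Sum>k\<in>J. \<bar>(b(j := b j + t)) k\<bar>) = (\<Sum>k\<in>J. \<bar>b k\<bar>) + (\<bar>b j + t\<bar> - \<bar>b j\<bar>)"
    by simp
  have sq: "sqn n (\<lambda>i. ?r i - t * X i j)
      = sqn n ?r - 2 * t * (\<Sum>i<n. X i j * ?r i) + t^2 * sqn n (\<lambda>i. X i j)"
  proof -
    have "(?r i - t * X i j)^2 = (?r i)^2 - 2 * t * (X i j * ?r i) + t^2 * (X i j)^2" for i
      by (simp add: power2_eq_square algebra_simps)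
    then show ?thesis
      unfolding sqn_def by (simp add: sum.distrib sum_subtractf sum_distrib_left)
  qed
  show ?thesis
    unfolding l1_obj_def res l1 score_def sq
    by (simp add: add_divide_distrib diff_divide_distrib algebra_simps)
qed

text \<open>Stands in for differentiation at 0: dividing by small \<open>t\<close> of either sign
  leaves only the linear coefficient.\<close>

lemma linear_le_quadratic_imp_zero:
  fixes a d e :: real
  assumes e: "0 < e" and h: "\<And>t. \<bar>t\<bar> < e \<Longrightarrow> 2 * t * d \<le> t^2 * a"
  shows "d = 0"
proof -
  have pos: "c \<le> 0" if c: "\<And>t. 0 < t \<Longrightarrow> t < e \<Longrightarrow> 2 * t * c \<le> t^2 * a" for c
  proof (rule ccontr)
    assume "\<not> c \<le> 0"
    then have c0: "0 < c" by simp
    define t where "t = min (e/2) (c / (\<bar>a\<bar> + 1))"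
    have t: "0 < t" "t < e" "t \<le> c / (\<bar>a\<bar> + 1)"
      using e c0 by (auto simp: t_def min_less_iff_disj)
    have "2 * c \<le> t * a"
      using c[OF t(1,2)] t(1) by (simp add: power2_eq_square)
    also have "\<dots> \<le> t * (\<bar>a\<bar> + 1)"
      using t(1) by (intro mult_left_mono) auto
    also have "\<dots> \<le> c"
      using t(3) by (simp add: field_simps)
    finally show False using c0 by simp
  qed
  have "d \<le> 0" using h by (intro pos) auto
  moreover have "- d \<le> 0"
    using h[of "- t" for t] by (intro pos) auto
  ultimately show ?thesis by simp
qed

text \<open>For \<open>\<bar>t\<bar> < \<bar>b j\<bar>\<close> the shifted coordinate keeps its
  sign, so the penalty is linear in \<open>t\<close> and the first-order condition is an
  equation.\<close>

lemma l1_min_score_eq: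
  assumes J: "finite J" "j \<in> J" and b: "l1_min n J X Y lam b" and nz: "b j \<noteq> 0"
  shows "score n J X Y b j = lam * sgn (b j)"
proof -
  let ?a = "sqn n (\<lambda>i. X i j) / real n"
  have "score n J X Y b j - lam * sgn (b j) = 0"
  proof (rule linear_le_quadratic_imp_zero)
    show "0 < \<bar>b j\<bar>" using nz by simp
    fix t :: real assume t: "\<bar>t\<bar> < \<bar>b j\<bar>"
    then have "\<bar>b j + t\<bar> - \<bar>b j\<bar> = t * sgn (b j)"
      by (auto simp: sgn_if abs_if split: if_splits)
    then show "2 * t * (score n J X Y b j - lam * sgn (b j)) \<le> t^2 * ?a"
      using l1_min_le[OF b, of "b(j := b j + t)"] l1_obj_coordinate_shift[OF J, of n X Y lam b t]
      by (simp add: algebra_simps)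
  qed
  then show ?thesis by simp
qed

lemma l1_min_score_le:
  assumes J: "finite J" "j \<in> J" and b: "l1_min n J X Y lam b" and lam: "0 \<le> lam"
  shows "\<bar>score n J X Y b j\<bar> \<le> lam"
proof (cases "b j = 0")
  case False
  then show ?thesis
    using l1_min_score_eq[OF J b False] lam by (simp add: abs_mult sgn_if)
next
  case True
  let ?a = "sqn n (\<lambda>i. X i j) / real n" and ?s = "score n J X Y b j"
  have step: "2 * t * ?s \<le> t^2 * ?a + 2 * lam * \<bar>t\<bar>" for t
    using l1_min_le[OF b, of "b(j := b j + t)"] l1_obj_coordinate_shift[OF J, of n X Y lam b t] True
    by (simp add: algebra_simps)
  have a0: "0 < ?a + 1" by (rule add_nonneg_pos) auto
  show ?thesis
  proof (rule ccontr)
    assume "\<not> ?thesis"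
    then have d: "0 < \<bar>?s\<bar> - lam" by simp
    \<comment> \<open>Up to the \<open>+ 1\<close>, which covers a vanishing column, this is the
      step that minimises the quadratic in the direction \<open>sgn ?s\<close>.\<close>
    define u where "u = (\<bar>?s\<bar> - lam) / (?a + 1)"
    have u: "0 < u" unfolding u_def using d a0 by (intro divide_pos_pos) auto
    have "2 * u * \<bar>?s\<bar> \<le> u^2 * ?a + 2 * lam * u"
      using step[of "u * sgn ?s"] u d lam by (auto simp: sgn_if abs_mult power_mult_distrib split: if_splits)
    then have "u * (2 * (\<bar>?s\<bar> - lam)) \<le> u * (u * ?a)"
      by (simp add: power2_eq_square algebra_simps)
    then have "2 * (\<bar>?s\<bar> - lam) \<le> u * ?a" using u mult_le_cancel_left_pos by blast
    also have "\<dots> \<le> u * (?a + 1)" using u by (intro mult_left_mono) auto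
    also have "\<dots> = \<bar>?s\<bar> - lam" using a0 by (simp add: u_def)
    finally show False using d by simp
  qed
qed

text \<open>Strong convexity in the fitted values: the fit is unique and depends
  continuously on the objective value even where the coefficients are not unique.\<close>

lemma l1_fit_stability:
  assumes b: "l1_min n J X Y lam b" and lam: "0 \<le> lam"
  shows "sqn n (\<lambda>i. (\<Sum>j\<in>J. X i j * g j) - (\<Sum>j\<in>J. X i j * b j)) / real n
    \<le> 2 * (l1_obj n J X Y lam g - l1_obj n J X Y lam b)"
proof -
  let ?f = "\<lambda>g i. \<Sum>j\<in>J. X i j * g j"
  \<comment> \<open>At the midpoint the squared loss lies below the average of the two losses by a
    quarter of the squared distance of the fits, and the penalty is at most its average. Optimality
    of \<open>b\<close> against \<open>h\<close> then yields the factor 2.\<close>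
  define h where "h j = (g j + b j) / 2" for j
  have fh: "?f h i = (?f g i + ?f b i) / 2" for i
    by (simp add: h_def sum.distrib[symmetric] sum_divide_distrib algebra_simps add_divide_distrib)
  have "(Y i - ?f h i)^2 = (Y i - ?f g i)^2 / 2 + (Y i - ?f b i)^2 / 2 - (?f g i - ?f b i)^2 / 4" for i
    unfolding fh by (simp add: power2_eq_square field_simps)
  then have sq: "sqn n (\<lambda>i. Y i - ?f h i) = sqn n (\<lambda>i. Y i - ?f g i) / 2
      + sqn n (\<lambda>i. Y i - ?f b i) / 2 - sqn n (\<lambda>i. ?f g i - ?f b i) / 4"
    unfolding sqn_def by (simp add: sum.distrib sum_subtractf sum_divide_distrib)
  have "(\<Sum>j\<in>J. \<bar>h j\<bar>) \<le> (\<Sum>j\<in>J. (\<bar>g j\<bar> + \<bar>b j\<bar>) / 2)"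
    by (intro sum_mono) (auto simp: h_def)
  also have "\<dots> = (\<Sum>j\<in>J. \<bar>g j\<bar>) / 2 + (\<Sum>j\<in>J. \<bar>b j\<bar>) / 2"
    by (simp add: sum.distrib sum_divide_distrib add_divide_distrib)
  finally have "2 * lam * (\<Sum>j\<in>J. \<bar>h j\<bar>) \<le> 2 * lam * ((\<Sum>j\<in>J. \<bar>g j\<bar>) / 2 + (\<Sum>j\<in>J. \<bar>b j\<bar>) / 2)"
    using lam by (intro mult_left_mono) auto
  moreover have "l1_obj n J X Y lam b \<le> l1_obj n J X Y lam h"
    by (rule l1_min_le[OF b])
  ultimately show ?thesis
    unfolding l1_obj_def sq by (simp add: add_divide_distrib diff_divide_distrib algebra_simps)
qed

lemma lasso_is_l1_min:
  assumes "0 < lam"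
  shows "l1_min n {..<p} X Y lam (lasso n p X Y lam)"
proof -
  have eq: "l1_min n {..<p} X Y lam b \<longleftrightarrow> (\<forall>j\<ge>p. b j = 0) \<and>
      (\<forall>b'. (\<forall>j\<ge>p. b' j = 0) \<longrightarrow> lasso_obj n p X Y lam b \<le> lasso_obj n p X Y lam b')" for b
    by (simp add: l1_min_def l1_obj_def lasso_obj_def mv_def not_less)
  show ?thesis
    unfolding lasso_def eq[symmetric]
    using someI_ex[OF l1_min_exists[of "{..<p}" lam n X Y]] assms by simp
qed

lemma gamma_hat_is_l1_min:
  assumes "0 < lam"
  shows "l1_min n {1..<p} X (\<lambda>i. X i 0) lam (gamma_hat n p X lam)"
proof -
  have "j \<notin> {1..<p} \<longleftrightarrow> j = 0 \<or> p \<le> j" for j by auto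
  then have eq: "l1_min n {1..<p} X (\<lambda>i. X i 0) lam b \<longleftrightarrow> (\<forall>j. j = 0 \<or> p \<le> j \<longrightarrow> b j = 0) \<and>
      (\<forall>b'. (\<forall>j. j = 0 \<or> p \<le> j \<longrightarrow> b' j = 0) \<longrightarrow> node_obj n p X lam b \<le> node_obj n p X lam b')" for b
    by (simp add: l1_min_def l1_obj_def node_obj_def del: atLeastLessThan_iff)
  show ?thesis
    unfolding gamma_hat_def eq[symmetric]
    using someI_ex[OF l1_min_exists[of "{1..<p}" lam n X "\<lambda>i. X i 0"]] assms by simp
qed

section \<open>Sparse eigenvalues and the l1 error of the Lasso\<close>

lemma l0norm_pos_iff: "1 \<le> l0norm p z \<longleftrightarrow> (\<exists>j<p. z j \<noteq> 0)"
  unfolding l0norm_def by (auto simp: Suc_le_eq card_gt_0_iff)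

lemma sum_sq_pos_iff: "0 < (\<Sum>j<p. (z j)^2) \<longleftrightarrow> (\<exists>j<p. z j \<noteq> 0)" for p :: nat and z :: "nat \<Rightarrow> real"
proof -
  have "0 \<le> (\<Sum>j<p. (z j)^2)" by (intro sum_nonneg) auto
  moreover have "(\<Sum>j<p. (z j)^2) = 0 \<longleftrightarrow> (\<forall>j<p. z j = 0)"
    by (subst sum_nonneg_eq_0_iff) auto
  ultimately show ?thesis by auto
qed

text \<open>Cauchy-Schwarz in every row. The crude constant serves to show that the set whose
  \<open>Sup\<close> defines \<open>phi_max\<close> is bounded above.\<close>

lemma sqn_mv_le: "sqn n (mv p X z) \<le> (\<Sum>i<n. \<Sum>j<p. (X i j)^2) * (\<Sum>j<p. (z j)^2)"
  unfolding sqn_def mv_def sum_distrib_right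
  by (intro sum_mono) (metis Cauchy_Schwarz_ineq_sum sum_distrib_right)

lemma phi_max_ge:
  assumes z: "\<forall>j\<ge>p. z j = 0" "l0norm p z \<le> s"
  shows "sqn n (mv p X z) / real n \<le> phi_max n p X s * (\<Sum>j<p. (z j)^2)"
proof (cases "\<exists>j<p. z j \<noteq> 0")
  case True
  let ?q = "\<lambda>z. sqn n (mv p X z) / (real n * (\<Sum>j<p. (z j)^2))"
  let ?Q = "{?q z | z. (\<forall>j\<ge>p. z j = 0) \<and> 1 \<le> l0norm p z \<and> l0norm p z \<le> s}"
  have pos: "0 < (\<Sum>j<p. (z j)^2)" using True sum_sq_pos_iff by blast
  have "?q z \<le> (\<Sum>i<n. \<Sum>j<p. (X i j)^2) / real n" if "1 \<le> l0norm p z" for z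
  proof -
    have "0 < (\<Sum>j<p. (z j)^2)" using that l0norm_pos_iff sum_sq_pos_iff by blast
    then have "sqn n (mv p X z) / (\<Sum>j<p. (z j)^2) \<le> (\<Sum>i<n. \<Sum>j<p. (X i j)^2)"
      using sqn_mv_le[of n p X z] by (simp add: divide_le_eq)
    from divide_right_mono[OF this, of "real n"] show ?thesis by (simp add: mult.commute)
  qed
  then have "bdd_above ?Q"
    by (intro bdd_aboveI[of _ "(\<Sum>i<n. \<Sum>j<p. (X i j)^2) / real n"]) blast
  moreover have "?q z \<in> ?Q" using z True l0norm_pos_iff by blast
  ultimately have "?q z \<le> phi_max n p X s"
    unfolding phi_max_def by (rule cSup_upper[rotated])
  then show ?thesis
    using pos by (cases "n = 0") (auto simp: field_simps)
next
  case False
  then have "mv p X z i = 0" for i unfolding mv_def by (intro sum.neutral) auto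
  with False show ?thesis by (simp add: sqn_def)
qed

lemma column_le_phi_max:
  assumes "j < p" "1 \<le> s"
  shows "sqn n (\<lambda>i. X i j) / real n \<le> phi_max n p X s"
proof -
  define e where "e = (\<lambda>l. if l = j then 1 else (0::real))"
  have "l0norm p e \<le> card {j}"
    unfolding l0norm_def by (intro card_mono) (auto simp: e_def)
  then have "sqn n (mv p X e) / real n \<le> phi_max n p X s * (\<Sum>l<p. (e l)^2)"
    using assms by (intro phi_max_ge) (auto simp: e_def)
  moreover have "(\<Sum>l<p. (e l)^2) = 1" "mv p X e = (\<lambda>i. X i j)"
    using assms by (auto simp: e_def mv_def if_distrib[of "\<lambda>x. x^2"] if_distrib[of "\<lambda>x. _ * x"] cong: if_cong)
  ultimately show ?thesis by simp
qed

lemma phi_min_le: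
  assumes z: "\<forall>j\<ge>p. z j = 0" "1 \<le> l0norm p z" "l0norm p z \<le> s" and n: "0 < n"
  shows "phi_min n p X s * (\<Sum>j<p. (z j)^2) \<le> sqn n (mv p X z) / real n"
proof -
  let ?q = "\<lambda>z. sqn n (mv p X z) / (real n * (\<Sum>j<p. (z j)^2))"
  let ?Q = "{?q z | z. (\<forall>j\<ge>p. z j = 0) \<and> 1 \<le> l0norm p z \<and> l0norm p z \<le> s}"
  have pos: "0 < (\<Sum>j<p. (z j)^2)" using z(2) l0norm_pos_iff sum_sq_pos_iff by blast
  have "bdd_below ?Q"
    by (intro bdd_belowI[of _ 0]) (auto intro!: divide_nonneg_nonneg mult_nonneg_nonneg sum_nonneg)
  moreover have "?q z \<in> ?Q" using z by blast
  ultimately have "phi_min n p X s \<le> ?q z"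
    unfolding phi_min_def by (rule cInf_lower[rotated])
  then show ?thesis
    using pos n by (simp add: field_simps)
qed

lemma kappa_sq_le:
  assumes S: "S \<subseteq> {..<p}" "card S \<le> s" and z: "\<forall>j\<ge>p. z j = 0"
    and cone: "(\<Sum>j\<in>{..<p} - S. \<bar>z j\<bar>) \<le> c0 * (\<Sum>j\<in>S. \<bar>z j\<bar>)" and n: "0 < n"
  shows "kappa_sq n p X s c0 * (\<Sum>j\<in>S. (z j)^2) \<le> sqn n (mv p X z) / real n"
proof (cases "\<exists>j<p. z j \<noteq> 0")
  case True
  let ?q = "\<lambda>S z. sqn n (mv p X z) / (real n * (\<Sum>j\<in>S. (z j)^2))"
  let ?Q = "{?q S z | S z.
      S \<subseteq> {..<p} \<and> card S \<le> s \<and> (\<forall>j\<ge>p. z j = 0) \<and> (\<exists>j<p. z j \<noteq> 0) \<and>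
      (\<Sum>j\<in>{..<p} - S. \<bar>z j\<bar>) \<le> c0 * (\<Sum>j\<in>S. \<bar>z j\<bar>)}"
  have "bdd_below ?Q"
    by (intro bdd_belowI[of _ 0]) (auto intro!: divide_nonneg_nonneg mult_nonneg_nonneg sum_nonneg)
  moreover have "?q S z \<in> ?Q" using assms True by blast
  ultimately have le: "kappa_sq n p X s c0 \<le> ?q S z"
    unfolding kappa_sq_def by (rule cInf_lower[rotated])
  \<comment> \<open>If \<open>z\<close> vanishes on \<open>S\<close>, the quotient is a division by
    zero and says nothing, but the left-hand side is then 0.\<close>
  show ?thesis
  proof (cases "(\<Sum>j\<in>S. (z j)^2) = 0")
    case True
    then show ?thesis by (simp only: mult_zero_right) simp
  next
    case False
    moreover have "0 \<le> (\<Sum>j\<in>S. (z j)^2)" by (intro sum_nonneg) auto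
    ultimately have "0 < (\<Sum>j\<in>S. (z j)^2)" by simp
    then show ?thesis using le n by (simp add: field_simps)
  qed
next
  case False
  then have "(\<Sum>j\<in>S. (z j)^2) = 0" using S by (intro sum.neutral) auto
  then show ?thesis by (simp only: mult_zero_right) simp
qed

section \<open>The cone argument\<close>

text \<open>Noise below \<open>lam / 2\<close> costs at most \<open>lam\<close> times the l1 norm of
  \<open>d\<close>, half of what the penalty \<open>2 * lam\<close> pays. Off \<open>S\<close> the
  penalty gains \<open>2 * lam\<close> and one \<open>lam\<close> remains; on \<open>S\<close> the
  two losses add up to \<open>3 * lam\<close>. This is the origin of the cone constant 3.\<close>

lemma lasso_basic_inequality:
  assumes b: "l1_min n {..<p} X Y lam b" and lam: "0 \<le> lam"
    and Y: "\<And>i. i < n \<Longrightarrow> Y i = mv p X beta i + e i"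
    and noise: "\<And>j. j < p \<Longrightarrow> \<bar>\<Sum>i<n. X i j * e i\<bar> / real n \<le> lam / 2"
  defines "S \<equiv> {j. j < p \<and> beta j \<noteq> 0}" and "d \<equiv> (\<lambda>j. b j - beta j)"
  shows "sqn n (mv p X d) / real n + lam * (\<Sum>j\<in>{..<p} - S. \<bar>d j\<bar>) \<le> 3 * lam * (\<Sum>j\<in>S. \<bar>d j\<bar>)"
proof -
  have split: "(\<Sum>j<p. f j) = (\<Sum>j\<in>S. f j) + (\<Sum>j\<in>{..<p} - S. f j)" for f :: "nat \<Rightarrow> real"
    by (subst sum.subset_diff[of S "{..<p}"]) (auto simp: S_def)
  have mvd: "mv p X d i = mv p X b i - mv p X beta i" for i
    by (simp add: mv_def d_def algebra_simps sum_subtractf)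
  have ob: "l1_obj n {..<p} X Y lam b
      = (sqn n e - 2 * (\<Sum>i<n. e i * mv p X d i) + sqn n (mv p X d)) / real n
        + 2 * lam * (\<Sum>j<p. \<bar>b j\<bar>)"
  proof -
    have "(Y i - (\<Sum>j<p. X i j * b j))^2 = (e i)^2 - 2 * (e i * mv p X d i) + (mv p X d i)^2"
      if "i < n" for i
      unfolding Y[OF that] mvd by (simp add: mv_def power2_eq_square algebra_simps)
    then show ?thesis
      unfolding l1_obj_def sqn_def by (simp add: sum.distrib sum_subtractf sum_distrib_left)
  qed
  have o0: "l1_obj n {..<p} X Y lam beta = sqn n e / real n + 2 * lam * (\<Sum>j<p. \<bar>beta j\<bar>)"
    unfolding l1_obj_def sqn_def by (simp add: Y mv_def)
  have "(\<Sum>i<n. e i * mv p X d i) = (\<Sum>j<p. d j * (\<Sum>i<n. X i j * e i))"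
    unfolding mv_def sum_distrib_left by (subst sum.swap) (simp add: mult_ac)
  then have "(\<Sum>i<n. e i * mv p X d i) / real n = (\<Sum>j<p. d j * ((\<Sum>i<n. X i j * e i) / real n))"
    by (simp only: sum_divide_distrib[of _ "{..<p}"] times_divide_eq_right)
  also have "\<dots> \<le> (\<Sum>j<p. \<bar>d j\<bar> * (lam / 2))"
  proof (intro sum_mono)
    fix j assume "j \<in> {..<p}"
    then have "\<bar>d j\<bar> * \<bar>(\<Sum>i<n. X i j * e i) / real n\<bar> \<le> \<bar>d j\<bar> * (lam / 2)"
      using noise[of j] by (intro mult_left_mono) auto
    then show "d j * ((\<Sum>i<n. X i j * e i) / real n) \<le> \<bar>d j\<bar> * (lam / 2)"
      unfolding abs_mult[symmetric] by linarith
  qed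
  also have "\<dots> = lam / 2 * (\<Sum>j<p. \<bar>d j\<bar>)" by (simp add: sum_distrib_left mult.commute)
  finally have cross: "2 * ((\<Sum>i<n. e i * mv p X d i) / real n) \<le> lam * (\<Sum>j<p. \<bar>d j\<bar>)" by linarith
  have "(\<Sum>j<p. \<bar>beta j\<bar>) - (\<Sum>j<p. \<bar>b j\<bar>) \<le> (\<Sum>j\<in>S. \<bar>d j\<bar>) - (\<Sum>j\<in>{..<p} - S. \<bar>d j\<bar>)"
  proof -
    have "(\<Sum>j\<in>S. \<bar>beta j\<bar>) - (\<Sum>j\<in>S. \<bar>b j\<bar>) \<le> (\<Sum>j\<in>S. \<bar>d j\<bar>)"
      unfolding sum_subtractf[symmetric] by (intro sum_mono) (auto simp: d_def)
    moreover have "(\<Sum>j\<in>{..<p} - S. \<bar>beta j\<bar>) = 0"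
      by (intro sum.neutral) (auto simp: S_def)
    moreover have "(\<Sum>j\<in>{..<p} - S. \<bar>b j\<bar>) = (\<Sum>j\<in>{..<p} - S. \<bar>d j\<bar>)"
      by (intro sum.cong) (auto simp: S_def d_def)
    ultimately show ?thesis unfolding split by simp
  qed
  then have "2 * lam * ((\<Sum>j<p. \<bar>beta j\<bar>) - (\<Sum>j<p. \<bar>b j\<bar>))
      \<le> 2 * lam * ((\<Sum>j\<in>S. \<bar>d j\<bar>) - (\<Sum>j\<in>{..<p} - S. \<bar>d j\<bar>))"
    using lam by (intro mult_left_mono) auto
  moreover have "l1_obj n {..<p} X Y lam b \<le> l1_obj n {..<p} X Y lam beta"
    by (rule l1_min_le[OF b])
  ultimately show ?thesis
    using cross unfolding ob o0 split[of "\<lambda>j. \<bar>d j\<bar>"]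
    by (simp add: add_divide_distrib diff_divide_distrib algebra_simps)
qed

text \<open>The cone condition admits \<open>d\<close> in \<open>kappa_sq\<close>, which bounds the
  squared l2 norm on \<open>S\<close> by \<open>3 * lam * ?L / kap\<close>. Cauchy-Schwarz over
  \<open>S\<close> turns this into a bound on \<open>?L\<close> itself, and the part off
  \<open>S\<close> brings the factor from 3 to 12. Here \<open>kap\<close> plays the role of the
  squared constant.\<close>

lemma lasso_l1_error:
  assumes b: "l1_min n {..<p} X Y lam b" and lam: "0 < lam" and n: "0 < n"
    and Y: "\<And>i. i < n \<Longrightarrow> Y i = mv p X beta i + e i" and beta: "\<forall>j\<ge>p. beta j = 0"
    and noise: "\<And>j. j < p \<Longrightarrow> \<bar>\<Sum>i<n. X i j * e i\<bar> / real n \<le> lam / 2"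
    and kap: "0 < kap" "kap \<le> kappa_sq n p X (l0norm p beta) 3"
  shows "(\<Sum>j<p. \<bar>b j - beta j\<bar>) \<le> 12 * lam * real (l0norm p beta) / kap"
proof -
  define S where "S = {j. j < p \<and> beta j \<noteq> 0}"
  define d where "d j = b j - beta j" for j
  let ?s = "real (card S)" and ?L = "\<Sum>j\<in>S. \<bar>d j\<bar>"
  have basic: "sqn n (mv p X d) / real n + lam * (\<Sum>j\<in>{..<p} - S. \<bar>d j\<bar>) \<le> 3 * lam * ?L"
    using lasso_basic_inequality[OF b less_imp_le[OF lam] Y noise]
    by (simp add: S_def d_def[abs_def])
  moreover have "0 \<le> sqn n (mv p X d) / real n" by simp
  ultimately have "lam * (\<Sum>j\<in>{..<p} - S. \<bar>d j\<bar>) \<le> 3 * lam * ?L" by linarith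
  then have "lam * (\<Sum>j\<in>{..<p} - S. \<bar>d j\<bar>) \<le> lam * (3 * ?L)" by (simp add: mult_ac)
  then have cone: "(\<Sum>j\<in>{..<p} - S. \<bar>d j\<bar>) \<le> 3 * ?L" using lam by simp
  have S: "S \<subseteq> {..<p}" "card S \<le> l0norm p beta" by (auto simp: S_def l0norm_def)
  have d0: "\<forall>j\<ge>p. d j = 0" using b beta by (simp add: d_def l1_min_def)
  have L0: "0 \<le> ?L" by (intro sum_nonneg) auto
  have sq0: "0 \<le> (\<Sum>j\<in>S. (d j)^2)" by (intro sum_nonneg) auto
  have "kap * (\<Sum>j\<in>S. (d j)^2) \<le> kappa_sq n p X (l0norm p beta) 3 * (\<Sum>j\<in>S. (d j)^2)"
    by (intro mult_right_mono kap sq0)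
  also have "\<dots> \<le> sqn n (mv p X d) / real n"
    by (rule kappa_sq_le[OF S d0 cone n])
  also have "\<dots> \<le> 3 * lam * ?L"
    using basic lam sum_nonneg[of "{..<p} - S" "\<lambda>j. \<bar>d j\<bar>"] by (smt (verit) abs_ge_zero mult_nonneg_nonneg)
  finally have quad: "kap * (\<Sum>j\<in>S. (d j)^2) \<le> 3 * lam * ?L" .
  have "?L^2 \<le> (\<Sum>j\<in>S. 1^2) * (\<Sum>j\<in>S. \<bar>d j\<bar>^2)"
    using Cauchy_Schwarz_ineq_sum[of "\<lambda>_. 1" "\<lambda>j. \<bar>d j\<bar>" S] by simp
  then have "?L^2 \<le> ?s * (\<Sum>j\<in>S. (d j)^2)" by simp
  then have "kap * ?L^2 \<le> ?s * (kap * (\<Sum>j\<in>S. (d j)^2))"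
    using kap by (simp add: mult.left_commute)
  also have "\<dots> \<le> ?s * (3 * lam * ?L)"
    using quad by (intro mult_left_mono) auto
  finally have "?L * (kap * ?L) \<le> ?L * (3 * lam * ?s)"
    by (simp add: power2_eq_square mult_ac)
  then have "kap * ?L \<le> 3 * lam * ?s"
    using L0 lam by (cases "?L = 0") (auto simp: mult_le_cancel_left)
  then have "?L \<le> 3 * lam * ?s / kap" using kap by (simp add: field_simps)
  moreover have "(\<Sum>j<p. \<bar>d j\<bar>) \<le> 4 * ?L"
    using cone sum.subset_diff[OF S(1), of "\<lambda>j. \<bar>d j\<bar>"] by simp
  ultimately show ?thesis by (simp add: d_def S_def l0norm_def)
qed

section \<open>The node-wise Lasso\<close>

definition node_resid :: "nat \<Rightarrow> nat \<Rightarrow> (nat \<Rightarrow> nat \<Rightarrow> real) \<Rightarrow> real \<Rightarrow> nat \<Rightarrow> real" where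
  "node_resid n p X lam i = X i 0 - (\<Sum>j\<in>{1..<p}. X i j * gamma_hat n p X lam j)"

lemma tau_tilde_sq_eq: "tau_tilde_sq n p X lam = sqn n (node_resid n p X lam) / real n"
  by (simp add: tau_tilde_sq_def node_resid_def[abs_def])

lemma score_gamma_hat:
  "score n {1..<p} X (\<lambda>i. X i 0) (gamma_hat n p X lam) j = (\<Sum>i<n. X i j * node_resid n p X lam i) / real n"
  by (simp add: score_def node_resid_def)

lemma sum_lessThan_split_0:
  fixes f :: "nat \<Rightarrow> real"
  assumes "0 < p"
  shows "(\<Sum>j<p. f j) = f 0 + (\<Sum>j\<in>{1..<p}. f j)"
proof -
  have "{..<p} = insert 0 {1..<p}" using assms by auto
  then show ?thesis by simp
qed

text \<open>Writing the first column as residual plus fit, the fit contributes \<open>gamma\<close>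
  times the scores, and by the equality case of the optimality conditions this is the l1 penalty.
  Hence \<open>tau_hat_sq\<close> is exactly the normalisation that makes the first entry of
  \<open>Sigma_hat\<close> times \<open>Theta_hat\<close> equal to 1 when it is positive.\<close>

lemma tau_hat_sq_eq:
  assumes lam: "0 < lam"
  shows "tau_hat_sq n p X lam = (\<Sum>i<n. X i 0 * node_resid n p X lam i) / real n"
proof -
  let ?g = "gamma_hat n p X lam" and ?r = "node_resid n p X lam"
  let ?s = "score n {1..<p} X (\<lambda>i. X i 0) ?g"
  have gs: "?g j * ?s j = lam * \<bar>?g j\<bar>" if "j \<in> {1..<p}" for j
  proof (cases "?g j = 0")
    case False
    then have "?s j = lam * sgn (?g j)"
      by (intro l1_min_score_eq[OF _ that gamma_hat_is_l1_min[OF lam]]) auto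
    then show ?thesis by (simp add: abs_sgn mult_ac)
  qed simp
  have "(\<Sum>i<n. X i 0 * ?r i) = (\<Sum>i<n. (?r i)^2 + (\<Sum>j\<in>{1..<p}. ?g j * (X i j * ?r i)))"
  proof (rule sum.cong)
    fix i
    have "X i 0 = ?r i + (\<Sum>j\<in>{1..<p}. X i j * ?g j)" by (simp add: node_resid_def)
    then have "X i 0 * ?r i = (?r i)^2 + (\<Sum>j\<in>{1..<p}. X i j * ?g j) * ?r i"
      by (metis distrib_right power2_eq_square)
    moreover have "(\<Sum>j\<in>{1..<p}. X i j * ?g j) * ?r i = (\<Sum>j\<in>{1..<p}. ?g j * (X i j * ?r i))"
      unfolding sum_distrib_right by (intro sum.cong) auto
    ultimately show "X i 0 * ?r i = (?r i)^2 + (\<Sum>j\<in>{1..<p}. ?g j * (X i j * ?r i))"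
      by simp
  qed simp
  also have "\<dots> = sqn n ?r + (\<Sum>j\<in>{1..<p}. ?g j * (\<Sum>i<n. X i j * ?r i))"
    unfolding sum.distrib sqn_def sum_distrib_left by (subst sum.swap) simp
  finally have "(\<Sum>i<n. X i 0 * ?r i) / real n
      = tau_tilde_sq n p X lam + (\<Sum>j\<in>{1..<p}. ?g j * ?s j)"
    unfolding score_gamma_hat tau_tilde_sq_eq
    by (simp only: add_divide_distrib sum_divide_distrib[of _ "{1..<p}"] times_divide_eq_right)
  also have "(\<Sum>j\<in>{1..<p}. ?g j * ?s j) = lam * (\<Sum>j\<in>{1..<p}. \<bar>?g j\<bar>)"
    unfolding sum_distrib_left by (intro sum.cong gs refl)
  finally show ?thesis by (simp add: tau_hat_sq_def)
qed

lemma mv_Theta_hat: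
  assumes "0 < p"
  shows "mv p X (Theta_hat n p X lam) i = node_resid n p X lam i / tau_hat_sq n p X lam"
proof -
  have "mv p X (Theta_hat n p X lam) i = X i 0 / tau_hat_sq n p X lam
      + (\<Sum>j\<in>{1..<p}. - (X i j * gamma_hat n p X lam j / tau_hat_sq n p X lam))"
    unfolding mv_def sum_lessThan_split_0[OF assms] Theta_hat_def
    by (auto intro!: sum.cong)
  then show ?thesis
    by (simp add: node_resid_def sum_negf sum_divide_distrib diff_divide_distrib)
qed

lemma Sigma_hat_mult:
  "(\<Sum>l<p. Sigma_hat n X j l * v l) = (\<Sum>i<n. X i j * mv p X v i) / real n"
proof -
  have "(\<Sum>l<p. (\<Sum>i<n. X i j * X i l) * v l) = (\<Sum>i<n. X i j * mv p X v i)"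
    unfolding mv_def sum_distrib_left sum_distrib_right by (subst sum.swap) (simp add: mult_ac)
  then show ?thesis
    by (simp add: Sigma_hat_def sum_divide_distrib[symmetric])
qed

lemma sum_mult_mv: "(\<Sum>j<p. v j * (\<Sum>i<n. X i j * w i)) = (\<Sum>i<n. mv p X v i * w i)"
  unfolding mv_def sum_distrib_left sum_distrib_right by (subst sum.swap) (simp add: mult_ac)

lemma Omega_hat_eq: "Omega_hat n p X lam = sqn n (mv p X (Theta_hat n p X lam)) / real n"
proof -
  let ?T = "Theta_hat n p X lam"
  have "Omega_hat n p X lam = (\<Sum>j<p. ?T j * (\<Sum>l<p. Sigma_hat n X j l * ?T l))"
    by (simp add: Omega_hat_def sum_distrib_left mult.assoc)
  also have "\<dots> = (\<Sum>j<p. ?T j * (\<Sum>i<n. X i j * mv p X ?T i)) / real n"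
    unfolding Sigma_hat_mult by (simp add: sum_divide_distrib[symmetric])
  finally show ?thesis
    by (simp add: sum_mult_mv sqn_def power2_eq_square)
qed

lemma W1_eq: "W1 n p X e lam = (\<Sum>i<n. mv p X (Theta_hat n p X lam) i / sqrt (real n) * e i)"
  unfolding W1_def sum_mult_mv by (simp add: sum_divide_distrib)

section \<open>The debiasing identity and its remainder\<close>

text \<open>Pure algebra: substituting \<open>Y - X b = e + X (beta - b)\<close> splits the
  correction into the noise part and a part linear in the estimation error. It holds for all tuning
  parameters.\<close>

lemma debiased_decomposition:
  assumes Y: "\<And>i. i < n \<Longrightarrow> Y i = mv p X beta i + e i" and p: "0 < p"
  shows "sqrt (real n) * (debiased1 n p X Y lam0 lam1 - beta 0)
    = W1 n p X e lam1 + Delta1 n p X Y beta lam0 lam1"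
proof (cases "n = 0")
  case True
  then show ?thesis by (simp add: W1_def Delta1_def)
next
  case False
  let ?T = "Theta_hat n p X lam1" and ?b = "lasso n p X Y lam0"
  define d where "d j = beta j - ?b j" for j
  have mvd: "mv p X d i = mv p X beta i - mv p X ?b i" for i
    by (simp add: mv_def d_def algebra_simps sum_subtractf)
  have sq: "sqrt (real n) * (x / real n) = x / sqrt (real n)" for x
    using False by (simp add: field_simps)
  have "(\<Sum>j<p. ?T j * (\<Sum>i<n. X i j * (Y i - mv p X ?b i))) = (\<Sum>i<n. mv p X ?T i * (Y i - mv p X ?b i))"
    by (rule sum_mult_mv)
  also have "\<dots> = (\<Sum>i<n. mv p X ?T i * e i) + (\<Sum>i<n. mv p X ?T i * mv p X d i)"
    unfolding sum.distrib[symmetric] mvd by (intro sum.cong) (auto simp: Y algebra_simps)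
  finally have "sqrt (real n) * (debiased1 n p X Y lam0 lam1 - beta 0)
      = (\<Sum>i<n. mv p X ?T i * e i) / sqrt (real n)
        + (sqrt (real n) * ((\<Sum>i<n. mv p X ?T i * mv p X d i) / real n) - sqrt (real n) * d 0)"
    unfolding debiased1_def sq[symmetric] by (simp add: d_def distrib_left right_diff_distrib add_divide_distrib)
  also have "(\<Sum>i<n. mv p X ?T i * e i) / sqrt (real n) = W1 n p X e lam1"
    by (simp add: W1_def sum_mult_mv)
  also have "sqrt (real n) * ((\<Sum>i<n. mv p X ?T i * mv p X d i) / real n) - sqrt (real n) * d 0
      = Delta1 n p X Y beta lam0 lam1"
  proof -
    have "(\<Sum>j<p. ((\<Sum>l<p. Sigma_hat n X j l * ?T l) - (if j = 0 then 1 else 0)) * d j)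
      = (\<Sum>j<p. d j * (\<Sum>i<n. X i j * mv p X ?T i) / real n) - (\<Sum>j<p. if j = 0 then d j else 0)"
      unfolding Sigma_hat_mult sum_subtractf[symmetric]
      by (intro sum.cong) (auto simp: algebra_simps)
    also have "(\<Sum>j<p. d j * (\<Sum>i<n. X i j * mv p X ?T i) / real n)
      = (\<Sum>i<n. mv p X ?T i * mv p X d i) / real n"
      unfolding sum_divide_distrib[symmetric] sum_mult_mv by (simp add: mult.commute)
    also have "(\<Sum>j<p. if j = 0 then d j else 0) = d 0"
      using p by simp
    finally show ?thesis
      unfolding Delta1_def d_def[symmetric] by (simp only: right_diff_distrib)
  qed
  finally show ?thesis .
qed

text \<open>These are the optimality conditions of the node-wise Lasso divided by
  \<open>tau_hat_sq\<close>: the error is 0 at index 0 by the normalisation, and elsewhere it is a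
  score.\<close>

lemma Sigma_hat_Theta_hat_close:
  assumes lam: "0 < lam" and j: "j < p" and tau: "0 < tau_hat_sq n p X lam"
  shows "\<bar>(\<Sum>l<p. Sigma_hat n X j l * Theta_hat n p X lam l) - (if j = 0 then 1 else 0)\<bar>
    \<le> lam / tau_hat_sq n p X lam"
proof -
  let ?r = "node_resid n p X lam" and ?t = "tau_hat_sq n p X lam"
  have "0 < p" using j by simp
  have eq: "(\<Sum>l<p. Sigma_hat n X j l * Theta_hat n p X lam l) = (\<Sum>i<n. X i j * ?r i) / real n / ?t"
    unfolding Sigma_hat_mult mv_Theta_hat[OF \<open>0 < p\<close>]
    by (simp add: sum_divide_distrib mult.commute)
  show ?thesis
  proof (cases "j = 0")
    case True
    then show ?thesis
      unfolding eq unfolding True tau_hat_sq_eq[OF lam, symmetric] using tau lam by simp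
  next
    case False
    then have "\<bar>(\<Sum>i<n. X i j * ?r i) / real n\<bar> \<le> lam"
      using l1_min_score_le[OF _ _ gamma_hat_is_l1_min[OF lam], of p j n X] j lam
      unfolding score_gamma_hat by simp
    then have "\<bar>(\<Sum>i<n. X i j * ?r i) / real n\<bar> / ?t \<le> lam / ?t"
      using tau by (intro divide_right_mono) auto
    then show ?thesis
      unfolding eq using False tau by (simp add: abs_divide)
  qed
qed

text \<open>Hoelder's inequality with the sup norm on the inverse approximation and the l1 norm on
  the Lasso error.\<close>

lemma Delta1_bound:
  assumes lam: "0 < lam1" and tau: "0 < tau_hat_sq n p X lam1"
  shows "\<bar>Delta1 n p X Y beta lam0 lam1\<bar>
    \<le> sqrt (real n) * lam1 / tau_hat_sq n p X lam1 * (\<Sum>j<p. \<bar>lasso n p X Y lam0 j - beta j\<bar>)"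
proof -
  let ?t = "tau_hat_sq n p X lam1"
  let ?a = "\<lambda>j. (\<Sum>l<p. Sigma_hat n X j l * Theta_hat n p X lam1 l) - (if j = 0 then 1 else 0)"
  have "\<bar>\<Sum>j<p. ?a j * (beta j - lasso n p X Y lam0 j)\<bar>
      \<le> (\<Sum>j<p. \<bar>?a j * (beta j - lasso n p X Y lam0 j)\<bar>)"
    by (rule sum_abs)
  also have "\<dots> \<le> (\<Sum>j<p. lam1 / ?t * \<bar>lasso n p X Y lam0 j - beta j\<bar>)"
  proof (rule sum_mono)
    fix j assume "j \<in> {..<p}"
    then have "\<bar>?a j\<bar> \<le> lam1 / ?t"
      using Sigma_hat_Theta_hat_close[OF lam _ tau, of j] by simp
    then show "\<bar>?a j * (beta j - lasso n p X Y lam0 j)\<bar> \<le> lam1 / ?t * \<bar>lasso n p X Y lam0 j - beta j\<bar>"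
      unfolding abs_mult abs_minus_commute[of "beta j"] by (rule mult_right_mono) simp
  qed
  also have "\<dots> = lam1 / ?t * (\<Sum>j<p. \<bar>lasso n p X Y lam0 j - beta j\<bar>)"
    by (simp add: sum_distrib_left)
  finally have "sqrt (real n) * \<bar>\<Sum>j<p. ?a j * (beta j - lasso n p X Y lam0 j)\<bar>
      \<le> sqrt (real n) * (lam1 / ?t * (\<Sum>j<p. \<bar>lasso n p X Y lam0 j - beta j\<bar>))"
    by (rule mult_left_mono) simp
  then show ?thesis
    by (simp add: Delta1_def abs_mult)
qed

section \<open>Support size and residual of the node-wise Lasso\<close>

lemma tau_tilde_sq_le: 
  assumes lam: "0 < lam"
  shows "tau_tilde_sq n p X lam \<le> sqn n (\<lambda>i. X i 0) / real n"
proof -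
  have "l1_obj n {1..<p} X (\<lambda>i. X i 0) lam (gamma_hat n p X lam) \<le> l1_obj n {1..<p} X (\<lambda>i. X i 0) lam (\<lambda>_. 0)"
    by (rule l1_min_le[OF gamma_hat_is_l1_min[OF lam]])
  moreover have "0 \<le> 2 * lam * (\<Sum>j\<in>{1..<p}. \<bar>gamma_hat n p X lam j\<bar>)"
    using lam by (intro mult_nonneg_nonneg sum_nonneg) auto
  ultimately show ?thesis
    by (simp add: l1_obj_def tau_tilde_sq_def)
qed

text \<open>The score has modulus \<open>lam\<close> on active coordinates, so its restriction \<open>z\<close> to \<open>S\<close> has squared norm
  \<open>card S * lam^2\<close>; this is also the inner product of \<open>X z\<close> with the residual over \<open>n\<close>.\<close>

lemma gamma_hat_active_subset:
  assumes lam: "0 < lam" and S: "S \<subseteq> {j\<in>{1..<p}. gamma_hat n p X lam j \<noteq> 0}" "card S \<le> m" "S \<noteq> {}"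
  shows "real (card S) * lam^2 \<le> phi_max n p X m * tau_tilde_sq n p X lam"
proof -
  let ?r = "node_resid n p X lam"
  define z where "z j = (if j \<in> S then (\<Sum>i<n. X i j * ?r i) / real n else 0)" for j
  have fin: "finite S" using S(1) by (rule finite_subset) simp
  have Sp: "S \<subseteq> {..<p}" using S by auto
  have zsq: "(z j)^2 = lam^2" if "j \<in> S" for j
  proof -
    have "score n {1..<p} X (\<lambda>i. X i 0) (gamma_hat n p X lam) j = lam * sgn (gamma_hat n p X lam j)"
      using S(1) that by (intro l1_min_score_eq gamma_hat_is_l1_min[OF lam]) auto
    then have "z j = lam * sgn (gamma_hat n p X lam j)"
      using that unfolding score_gamma_hat by (simp add: z_def)
    moreover have "gamma_hat n p X lam j \<noteq> 0" using S(1) that by auto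
    ultimately show ?thesis by (simp add: power_mult_distrib sgn_if)
  qed
  have sumz: "(\<Sum>j<p. (z j)^2) = real (card S) * lam^2"
  proof -
    have "(\<Sum>j<p. (z j)^2) = (\<Sum>j\<in>S. (z j)^2)"
      using Sp by (intro sum.mono_neutral_right) (auto simp: z_def)
    then show ?thesis by (simp add: zsq)
  qed
  let ?N = "real (card S) * lam^2" and ?P = "phi_max n p X m"
  have "(\<Sum>j<p. (z j)^2) = (\<Sum>j<p. z j * (\<Sum>i<n. X i j * ?r i)) / real n"
    unfolding sum_divide_distrib by (intro sum.cong) (auto simp: z_def power2_eq_square)
  also have "\<dots> = (\<Sum>i<n. mv p X z i * ?r i) / real n"
    by (simp add: sum_mult_mv)
  finally have "?N^2 = (\<Sum>i<n. mv p X z i * ?r i)^2 / real n^2"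
    unfolding sumz by (simp add: power_divide)
  also have "\<dots> \<le> (sqn n (mv p X z) * sqn n ?r) / real n^2"
    unfolding sqn_def by (intro divide_right_mono Cauchy_Schwarz_ineq_sum) simp
  also have "\<dots> = sqn n (mv p X z) / real n * tau_tilde_sq n p X lam"
    by (simp add: tau_tilde_sq_eq power2_eq_square)
  also have "\<dots> \<le> (?P * ?N) * tau_tilde_sq n p X lam"
  proof (rule mult_right_mono)
    have "l0norm p z \<le> card S"
      unfolding l0norm_def using fin by (intro card_mono) (auto simp: z_def split: if_splits)
    moreover have "\<forall>j\<ge>p. z j = 0" using Sp by (auto simp: z_def)
    ultimately show "sqn n (mv p X z) / real n \<le> ?P * ?N"
      using phi_max_ge[of p z m n X] S(2) unfolding sumz by simp
  qed (simp add: tau_tilde_sq_eq)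
  finally have "?N * ?N \<le> ?N * (?P * tau_tilde_sq n p X lam)"
    by (simp add: power2_eq_square mult_ac)
  moreover have "0 < ?N"
    using fin lam S(3) by (simp add: card_gt_0_iff)
  ultimately show ?thesis
    using mult_le_cancel_left_pos by blast
qed

text \<open>A small support makes \<open>(1, -gamma)\<close> an \<open>m\<close>-sparse vector whose
  image under \<open>X\<close> is the residual; its leading 1 keeps the squared norm at least 1, so
  \<open>phi_min\<close> bounds the residual from below.\<close>

lemma tau_tilde_sq_ge:
  assumes n: "n = K * m" "0 < K" "2 \<le> m" "n < p" and C: "0 < C" "phi_max n p X n \<le> C"
    and D: "0 < D" "D \<le> phi_min n p X m"
    and lam: "lam = 2 * C * real K / sqrt (real n)"
  shows "D \<le> tau_tilde_sq n p X lam"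
proof -
  let ?g = "gamma_hat n p X lam" and ?t = "tau_tilde_sq n p X lam"
  define A where "A = {j\<in>{1..<p}. ?g j \<noteq> 0}"
  have n0: "0 < n" using n by simp
  then have lam0: "0 < lam" using n C by (simp add: lam)
  have t0: "0 \<le> ?t" by (simp add: tau_tilde_sq_eq)
  have "?t \<le> sqn n (\<lambda>i. X i 0) / real n" by (rule tau_tilde_sq_le[OF lam0])
  also have "\<dots> \<le> C"
    using column_le_phi_max[of 0 p n n X] n n0 C by simp
  finally have tC: "?t \<le> C" .
  \<comment> \<open>The residual on the right is at most \<open>C\<close> by comparison with
    \<open>gamma = 0\<close>. Inserting \<open>lam\<close> leaves
    \<open>card S * 4 * K^2 \<le> n = K * m\<close>, in which \<open>C\<close> has
    cancelled.\<close>
  have small: "4 * card S \<le> m" if S: "S \<subseteq> A" "card S \<le> n" for S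
  proof (cases "S = {}")
    case False
    have "real (card S) * lam^2 \<le> phi_max n p X n * ?t"
      using S False by (intro gamma_hat_active_subset[OF lam0]) (auto simp: A_def)
    also have "\<dots> \<le> C * ?t" by (intro mult_right_mono C t0)
    also have "\<dots> \<le> C * C" using tC C by (intro mult_left_mono) auto
    finally have "real (card S) * (4 * (C * C) * real K^2) \<le> C * C * real n"
      using n0 by (simp add: lam power_divide power_mult_distrib power2_eq_square field_simps)
    then have "(C * C) * (real (card S) * 4 * real K^2) \<le> (C * C) * real n"
      by (simp add: mult_ac)
    moreover have "0 < C * C" using C by simp
    ultimately have "real (card S) * 4 * real K^2 \<le> real n"
      using mult_le_cancel_left_pos by blast
    then have "real K * (real (card S) * 4 * real K) \<le> real K * real m"
      by (simp add: n power2_eq_square mult_ac)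
    then have "real (card S) * 4 * real K \<le> real m" using n(2) by simp
    moreover have "real (card S) * 4 * 1 \<le> real (card S) * 4 * real K"
      using n(2) by (intro mult_left_mono) auto
    ultimately show ?thesis by linarith
  qed simp
  \<comment> \<open>A larger support would contain a subset of size exactly \<open>n\<close>, and
    then \<open>4 * n \<le> m \<le> n\<close>.\<close>
  have cardA: "card A \<le> n"
  proof (rule ccontr)
    assume "\<not> card A \<le> n"
    then obtain S where "S \<subseteq> A" "card S = n"
      by (meson nat_le_linear obtain_subset_with_card_n)
    with small[of S] have "4 * n \<le> m" by simp
    moreover have "m \<le> n" using n by simp
    ultimately show False using n0 by simp
  qed
  define z where "z j = (if j = 0 then 1 else - ?g j)" for j
  have g0: "?g j = 0" if "j \<ge> p" for j
    using gamma_hat_is_l1_min[OF lam0, of n p X] that by (simp add: l1_min_def)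
  have p0: "0 < p" using n by simp
  have "l0norm p z \<le> card (insert 0 A)"
    unfolding l0norm_def by (intro card_mono) (auto simp: A_def z_def split: if_splits)
  also have "\<dots> \<le> card A + 1" by (simp add: card_insert_if A_def)
  also have "\<dots> \<le> m" using small[OF order_refl cardA] n by simp
  finally have l0: "l0norm p z \<le> m" .
  have "phi_min n p X m * (\<Sum>j<p. (z j)^2) \<le> sqn n (mv p X z) / real n"
  proof (rule phi_min_le[OF _ _ l0 n0])
    show "\<forall>j\<ge>p. z j = 0" using g0 p0 by (auto simp: z_def)
    show "1 \<le> l0norm p z" unfolding l0norm_pos_iff using p0 by (auto simp: z_def intro!: exI[of _ 0])
  qed
  also have "mv p X z = node_resid n p X lam"
  proof
    fix i
    have "(\<Sum>j\<in>{1..<p}. X i j * z j) = - (\<Sum>j\<in>{1..<p}. X i j * ?g j)"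
      unfolding sum_negf[symmetric] by (intro sum.cong) (auto simp: z_def)
    then show "mv p X z i = node_resid n p X lam i"
      unfolding mv_def sum_lessThan_split_0[OF p0] node_resid_def by (simp add: z_def)
  qed
  finally have le: "phi_min n p X m * (\<Sum>j<p. (z j)^2) \<le> ?t" by (simp add: tau_tilde_sq_eq)
  have "1 \<le> (\<Sum>j<p. (z j)^2)"
    unfolding sum_lessThan_split_0[OF p0] by (simp add: z_def sum_nonneg)
  then have "D * 1 \<le> phi_min n p X m * (\<Sum>j<p. (z j)^2)"
    using D by (intro mult_mono) auto
  with le show ?thesis by simp
qed

lemma tau_tilde_sq_le_tau_hat_sq: "0 \<le> lam \<Longrightarrow> tau_tilde_sq n p X lam \<le> tau_hat_sq n p X lam"
  by (simp add: tau_hat_sq_def sum_nonneg)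

lemma Omega_hat_eq_tau:
  "0 < p \<Longrightarrow> Omega_hat n p X lam = tau_tilde_sq n p X lam / (tau_hat_sq n p X lam)^2"
  by (simp add: Omega_hat_eq mv_Theta_hat sqn_def tau_tilde_sq_eq power_divide sum_divide_distrib[symmetric])

text \<open>The variance is \<open>tau_tilde_sq\<close> over the square of
  \<open>tau_hat_sq\<close>, and the larger \<open>tau_hat_sq\<close> cancels one factor.\<close>

lemma Omega_hat_le:
  assumes "0 < p" "0 \<le> lam" "0 < D" "D \<le> tau_tilde_sq n p X lam"
  shows "0 \<le> Omega_hat n p X lam" "Omega_hat n p X lam \<le> 1 / D"
proof -
  let ?t = "tau_hat_sq n p X lam" and ?s = "tau_tilde_sq n p X lam"
  have le: "?s \<le> ?t" using assms(2) by (rule tau_tilde_sq_le_tau_hat_sq)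
  show "0 \<le> Omega_hat n p X lam" by (simp add: Omega_hat_eq)
  have "?s / ?t^2 \<le> ?t / ?t^2" using le by (intro divide_right_mono) auto
  also have "\<dots> = 1 / ?t" using assms le by (simp add: power2_eq_square)
  also have "\<dots> \<le> 1 / D" using assms le by (intro divide_left_mono mult_pos_pos) auto
  finally show "Omega_hat n p X lam \<le> 1 / D" by (simp add: Omega_hat_eq_tau[OF assms(1)])
qed

section \<open>Measurability of the node-wise residual\<close>

lemma matM_entry [measurable]: "(\<lambda>X. X i j) \<in> borel_measurable matM"
  unfolding matM_def
  by (rule measurable_compose[OF measurable_component_singleton[of i UNIV] measurable_component_singleton[of j UNIV]]) auto

text \<open>Countable, yet approximating every vector on \<open>J\<close>, so that a selection can
  run through an enumeration.\<close>

definition rat_vecs :: "nat set \<Rightarrow> (nat \<Rightarrow> real) set" where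
  "rat_vecs J = (\<lambda>f j. if j \<in> J then f j else 0) ` (PiE J (\<lambda>_. \<rat>))"

lemma countable_rat_vecs: "finite J \<Longrightarrow> countable (rat_vecs J)"
  unfolding rat_vecs_def by (intro countable_image countable_PiE countable_rat)

lemma rat_vecs_approx:
  "\<exists>q. (\<forall>m. q m \<in> rat_vecs J) \<and> (\<forall>j\<in>J. (\<lambda>m. q m j) \<longlonglongrightarrow> (b j :: real))"
proof -
  have "\<exists>x\<in>\<rat>. b j < x \<and> x < b j + 1 / real (Suc m)" for j m
    by (rule Rats_dense_in_real) simp
  then obtain x where x: "\<And>j m. x j m \<in> \<rat>" "\<And>j m. b j < x j m" "\<And>j m. x j m < b j + 1 / real (Suc m)"
    by metis
  define q where "q m j = (if j \<in> J then x j m else 0)" for m j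
  have "q m \<in> rat_vecs J" for m
    unfolding rat_vecs_def
    by (rule image_eqI[of _ _ "\<lambda>j\<in>J. x j m"]) (auto simp: q_def x)
  moreover have "(\<lambda>m. q m j) \<longlonglongrightarrow> b j" if "j \<in> J" for j
  proof (rule tendsto_sandwich[of "\<lambda>_. b j"])
    show "(\<lambda>m. b j + 1 / real (Suc m)) \<longlonglongrightarrow> b j"
      using tendsto_add[OF tendsto_const LIMSEQ_Suc[OF lim_1_over_n]] by simp
  qed (use that less_imp_le[OF x(2)] less_imp_le[OF x(3)] in \<open>auto simp: q_def\<close>)
  ultimately show ?thesis by blast
qed

lemma l1_obj_tendsto:
  assumes "finite J" "\<And>j. j \<in> J \<Longrightarrow> (\<lambda>m. q m j) \<longlonglongrightarrow> b j"
  shows "(\<lambda>m. l1_obj n J X Y lam (q m)) \<longlonglongrightarrow> l1_obj n J X Y lam b"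
  unfolding l1_obj_def sqn_def divide_inverse using assms by (intro tendsto_intros) auto

text \<open>The selection of a minimiser is not known to be measurable, but its fitted values are limits of
  the fits of the first near-optimal vectors in an enumeration of the rational ones.\<close>

lemma node_resid_measurable:
  assumes lam: "0 < lam" and i: "i < n"
  shows "(\<lambda>X. node_resid n p X lam i) \<in> borel_measurable matM"
proof -
  let ?J = "{1..<p}"
  let ?f = "\<lambda>X. l1_obj n ?J X (\<lambda>i. X i 0) lam"
  define q where "q = from_nat_into (rat_vecs ?J)"
  have ne: "rat_vecs ?J \<noteq> {}" unfolding rat_vecs_def by (auto simp: PiE_eq_empty_iff)
  have range_q: "range q = rat_vecs ?J"
    unfolding q_def using ne by (intro range_from_nat_into countable_rat_vecs) auto
  have f_meas [measurable]: "(\<lambda>X. ?f X g) \<in> borel_measurable matM" for g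
    unfolding l1_obj_def sqn_def by measurable
  \<comment> \<open>Near-optimality is tested against the other rational vectors and not against the
    true minimum: the test is a countable conjunction of measurable comparisons, which makes the
    least index measurable.\<close>
  define N where "N m X = (LEAST k. \<forall>l. ?f X (q k) \<le> ?f X (q l) + 1 / real (Suc m))" for m X
  have [measurable]: "Measurable.pred matM (\<lambda>X. ?f X (q k) \<le> ?f X (q l) + 1 / real (Suc m))" for k l m
    unfolding pred_def by (intro borel_measurable_le borel_measurable_add f_meas borel_measurable_const)
  have N_meas [measurable]: "N m \<in> measurable matM (count_space UNIV)" for m
    unfolding N_def by measurable
  define R where "R m X = X i 0 - (\<Sum>j\<in>?J. X i j * q (N m X) j)" for m X
  have R_meas: "R m \<in> borel_measurable matM" for m
  proof -
    have "(\<lambda>X. X i 0 - (\<Sum>j\<in>?J. X i j * q k j)) \<in> borel_measurable matM" for k by measurable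
    then show ?thesis
      unfolding R_def by (rule measurable_compose_countable[OF _ N_meas])
  qed
  have "(\<lambda>m. R m X) \<longlonglongrightarrow> node_resid n p X lam i" for X
  proof -
    let ?g = "gamma_hat n p X lam"
    have g: "l1_min n ?J X (\<lambda>i. X i 0) lam ?g" by (rule gamma_hat_is_l1_min[OF lam])
    obtain w where w: "\<And>m. w m \<in> rat_vecs ?J" "\<And>j. j \<in> ?J \<Longrightarrow> (\<lambda>m. w m j) \<longlonglongrightarrow> ?g j"
      using rat_vecs_approx[of ?J ?g] by blast
    have wlim: "(\<lambda>m. ?f X (w m)) \<longlonglongrightarrow> ?f X ?g"
      by (rule l1_obj_tendsto) (use w in auto)
    have near: "\<exists>k. ?f X (q k) < ?f X ?g + e" if "0 < e" for e
    proof -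
      have "\<forall>\<^sub>F m in sequentially. ?f X (w m) < ?f X ?g + e"
        using order_tendstoD(2)[OF wlim, of "?f X ?g + e"] that by simp
      then obtain m where "?f X (w m) < ?f X ?g + e"
        using eventually_happens by fastforce
      moreover have "w m \<in> range q" using w range_q by simp
      ultimately show ?thesis by auto
    qed
    have opt: "?f X (q (N m X)) \<le> ?f X ?g + 1 / real (Suc m)" for m
    proof -
      obtain k where "?f X (q k) < ?f X ?g + 1 / real (Suc m)"
        using near[of "1 / real (Suc m)"] by auto
      then have "\<forall>l. ?f X (q k) \<le> ?f X (q l) + 1 / real (Suc m)"
        using l1_min_le[OF g] by (meson add_le_cancel_right less_imp_le order_trans)
      then have "\<forall>l. ?f X (q (N m X)) \<le> ?f X (q l) + 1 / real (Suc m)"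
        unfolding N_def by (rule LeastI)
      then have "?f X (q (N m X)) - 1 / real (Suc m) \<le> ?f X (q l)" for l
        by (simp add: diff_le_eq)
      then have "?f X (q (N m X)) - 1 / real (Suc m) \<le> ?f X ?g + e" if "0 < e" for e
        using near[OF that] by (meson less_imp_le order_trans)
      then have "?f X (q (N m X)) - 1 / real (Suc m) \<le> ?f X ?g"
        by (rule field_le_epsilon)
      then show ?thesis by linarith
    qed
    \<comment> \<open>The vectors \<open>q (N m X)\<close> themselves need not converge; strong
      convexity in the fitted values controls only their fits.\<close>
    have bound: "(R m X - node_resid n p X lam i)^2 \<le> 2 * real n * (1 / real (Suc m))" for m
    proof -
      let ?d = "\<lambda>i. (\<Sum>j\<in>?J. X i j * q (N m X) j) - (\<Sum>j\<in>?J. X i j * ?g j)"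
      have "(R m X - node_resid n p X lam i)^2 = (?d i)^2"
        by (simp add: R_def node_resid_def power2_commute)
      also have "\<dots> \<le> sqn n ?d"
        unfolding sqn_def using i by (intro member_le_sum) auto
      also have "\<dots> = real n * (sqn n ?d / real n)" using i by simp
      also have "\<dots> \<le> real n * (2 * (?f X (q (N m X)) - ?f X ?g))"
        using lam by (intro mult_left_mono l1_fit_stability[OF g]) auto
      also have "\<dots> \<le> real n * (2 * (1 / real (Suc m)))"
        using opt[of m] by (intro mult_left_mono) auto
      finally show ?thesis by (simp add: mult.commute)
    qed
    have "(\<lambda>m. (R m X - node_resid n p X lam i)^2) \<longlonglongrightarrow> 0"
    proof (rule tendsto_sandwich[of "\<lambda>_. 0"])
      show "(\<lambda>m. 2 * real n * (1 / real (Suc m))) \<longlonglongrightarrow> 0"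
        using tendsto_mult[OF tendsto_const LIMSEQ_Suc[OF lim_1_over_n], of "2 * real n"] by simp
    qed (use bound in auto)
    then have "(\<lambda>m. sqrt ((R m X - node_resid n p X lam i)^2)) \<longlonglongrightarrow> sqrt 0"
      by (rule tendsto_real_sqrt)
    then have "(\<lambda>m. R m X - node_resid n p X lam i) \<longlonglongrightarrow> 0"
      by (simp add: tendsto_rabs_zero_iff)
    then show ?thesis by (simp add: LIM_zero_iff)
  qed
  then show ?thesis
    by (rule borel_measurable_LIMSEQ_real) (rule R_meas)
qed

lemma Theta_hat_fit_measurable:
  assumes lam: "0 < lam" and p: "0 < p" and i: "i < n"
  shows "(\<lambda>X. mv p X (Theta_hat n p X lam) i) \<in> borel_measurable matM"
proof -
  note [measurable] = node_resid_measurable[OF lam]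
  have [measurable]: "(\<lambda>X. \<Sum>i<n. X i 0 * node_resid n p X lam i) \<in> borel_measurable matM"
    by (intro borel_measurable_sum borel_measurable_times) auto
  show ?thesis
    unfolding mv_Theta_hat[OF p] tau_hat_sq_eq[OF lam] using i by measurable
qed

section \<open>Gaussian linear forms\<close>

lemma normal_law_sets [measurable_cong, simp]: "sets (normal_law v) = sets borel"
  by (simp add: normal_law_def)

lemma normal_law_prob: "prob_space (normal_law v)"
  by (auto simp: normal_law_def intro!: prob_space_return prob_space_normal_density)

text \<open>Both sides agree on rectangles, where the integral of a product factorises. This links
  the joint-density form of the noise assumption to the product measure used with Fubini's
  theorem.\<close>

lemma PiM_density:
  fixes f :: "'i \<Rightarrow> real \<Rightarrow> ennreal"
  assumes "finite I" and f [measurable]: "\<And>i. i \<in> I \<Longrightarrow> f i \<in> borel_measurable lborel"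
    and p: "\<And>i. prob_space (density lborel (f i))"
  shows "density (PiM I (\<lambda>_. lborel)) (\<lambda>x. \<Prod>i\<in>I. f i (x i)) = PiM I (\<lambda>i. density lborel (f i))"
proof -
  interpret L: product_sigma_finite "\<lambda>_. lborel :: real measure" by standard
  interpret D: product_prob_space "\<lambda>i. density lborel (f i)"
    using p by (intro product_prob_spaceI)
  show ?thesis
  proof (rule D.PiM_eqI)
    show "finite I" by fact
    show "sets (density (PiM I (\<lambda>_. lborel)) (\<lambda>x. \<Prod>i\<in>I. f i (x i))) = sets (PiM I (\<lambda>i. density lborel (f i)))"
      by (simp cong: sets_PiM_cong)
    fix A assume A: "\<And>i. i \<in> I \<Longrightarrow> A i \<in> sets (density lborel (f i))"
    have [measurable]: "PiE I A \<in> sets (PiM I (\<lambda>_. lborel))"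
      using A \<open>finite I\<close> by (intro sets_PiM_I_finite) auto
    have [measurable]: "(\<lambda>x. \<Prod>i\<in>I. f i (x i)) \<in> borel_measurable (PiM I (\<lambda>_. lborel))"
    proof (rule borel_measurable_prod_ennreal)
      fix i assume i: "i \<in> I"
      show "(\<lambda>x. f i (x i)) \<in> borel_measurable (PiM I (\<lambda>_. lborel))"
        by (rule measurable_compose[OF measurable_component_singleton[OF i] f[OF i]])
    qed
    have "emeasure (density (PiM I (\<lambda>_. lborel)) (\<lambda>x. \<Prod>i\<in>I. f i (x i))) (PiE I A)
       = (\<integral>\<^sup>+x. (\<Prod>i\<in>I. f i (x i)) * indicator (PiE I A) x \<partial>PiM I (\<lambda>_. lborel))"
      by (rule emeasure_density) measurable
    also have "\<dots> = (\<integral>\<^sup>+x. (\<Prod>i\<in>I. f i (x i) * indicator (A i) (x i)) \<partial>PiM I (\<lambda>_. lborel))"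
    proof (rule nn_integral_cong)
      fix x assume "x \<in> space (PiM I (\<lambda>_. lborel :: real measure))"
      then have "indicator (PiE I A) x = (\<Prod>i\<in>I. indicator (A i) (x i) :: ennreal)"
        using \<open>finite I\<close> by (auto simp: space_PiM PiE_iff indicator_def prod_zero_iff)
      then show "(\<Prod>i\<in>I. f i (x i)) * indicator (PiE I A) x = (\<Prod>i\<in>I. f i (x i) * indicator (A i) (x i))"
        by (simp add: prod.distrib)
    qed
    also have "\<dots> = (\<Prod>i\<in>I. \<integral>\<^sup>+x. f i x * indicator (A i) x \<partial>lborel)"
    proof (rule L.product_nn_integral_prod)
      fix i assume i: "i \<in> I"
      have [measurable]: "A i \<in> sets lborel" using A[OF i] by simp
      show "(\<lambda>x. f i x * indicator (A i) x) \<in> borel_measurable lborel" using f[OF i] by measurable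
    qed fact
    also have "\<dots> = (\<Prod>i\<in>I. emeasure (density lborel (f i)) (A i))"
      using A f by (intro prod.cong) (auto simp: emeasure_density)
    finally show "emeasure (density (PiM I (\<lambda>_. lborel)) (\<lambda>x. \<Prod>i\<in>I. f i (x i))) (PiE I A)
       = (\<Prod>i\<in>I. emeasure (density lborel (f i)) (A i))" .
  qed
qed

definition noise_law :: "nat \<Rightarrow> real \<Rightarrow> (nat \<Rightarrow> real) measure" where
  "noise_law n sd = PiM {..<n} (\<lambda>_. density lborel (normal_density 0 sd))"

lemma noise_law_sets [measurable_cong]: "sets (noise_law n sd) = sets (PiM {..<n} (\<lambda>_. borel))"
  unfolding noise_law_def by (intro sets_PiM_cong) auto

text \<open>The coordinates are independent normals under the product law, and sums of independent
  normals are normal. The case of zero variance is the point mass built into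
  \<open>normal_law\<close>.\<close>

lemma noise_law_linear_form:
  assumes sd: "0 < sd"
  shows "distr (noise_law n sd) borel (\<lambda>x. \<Sum>i<n. u i * x i)
    = normal_law (sd^2 * (\<Sum>i<n. (u i)^2))"
proof -
  let ?N = "density lborel (normal_density 0 sd)"
  interpret D: product_prob_space "\<lambda>i::nat. ?N"
    using sd by (intro product_prob_spaceI prob_space_normal_density)
  interpret P: prob_space "noise_law n sd"
    unfolding noise_law_def using sd by (intro prob_space_PiM prob_space_normal_density)
  have comp [measurable]: "(\<lambda>x. x i) \<in> measurable (noise_law n sd) borel" if "i < n" for i
    using that unfolding noise_law_def by (intro measurable_compose[OF measurable_component_singleton]) auto
  have coord: "distributed (noise_law n sd) lborel (\<lambda>x. x i) (normal_density 0 sd)" if "i < n" for i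
    unfolding distributed_def
  proof safe
    have "distr (noise_law n sd) lborel (\<lambda>x. x i) = distr (PiM {..<n} (\<lambda>_. ?N)) ?N (\<lambda>x. x i)"
      unfolding noise_law_def by (intro distr_cong) auto
    also have "\<dots> = ?N" using that by (intro distr_PiM_component) (auto intro: prob_space_normal_density sd)
    finally show "distr (noise_law n sd) lborel (\<lambda>x. x i) = ?N" .
  qed (use comp[OF that] in simp_all)
  \<comment> \<open>The summation theorem for normals asks for a nonempty index set and positive
    variances, so vanishing coefficients are dropped first.\<close>
  define I where "I = {i. i < n \<and> u i \<noteq> 0}"
  have sumI: "(\<Sum>i<n. u i * x i) = (\<Sum>i\<in>I. u i * x i)" for x
    by (rule sum.mono_neutral_right) (auto simp: I_def)
  have sumI2: "(\<Sum>i<n. (u i)^2) = (\<Sum>i\<in>I. (u i)^2)"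
    by (rule sum.mono_neutral_right) (auto simp: I_def)
  show ?thesis
  proof (cases "I = {}")
    case True
    then show ?thesis
      unfolding sumI sumI2 by (simp add: normal_law_def P.distr_const)
  next
    case False
    have "P.indep_vars (\<lambda>_. borel) (\<lambda>i x. x i) {..<n}"
    proof (subst P.indep_vars_iff_distr_eq_PiM')
      have "distr (noise_law n sd) (PiM {..<n} (\<lambda>_. borel)) (\<lambda>x. \<lambda>i\<in>{..<n}. x i)
        = distr (noise_law n sd) (noise_law n sd) (\<lambda>x. x)"
      proof (rule distr_cong)
        show "sets (PiM {..<n} (\<lambda>_. borel)) = sets (noise_law n sd)"
          by (rule noise_law_sets[symmetric])
      qed (auto simp: noise_law_def space_PiM PiE_def extensional_restrict)
      also have "\<dots> = noise_law n sd" by simp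
      also have "\<dots> = PiM {..<n} (\<lambda>i. distr (noise_law n sd) borel (\<lambda>x. x i))"
      proof -
        have "distr (noise_law n sd) borel (\<lambda>x. x i) = ?N" if "i < n" for i
          using distributed_distr_eq_density[OF coord[OF that]] by (metis distr_cong sets_lborel)
        then show ?thesis unfolding noise_law_def[of n sd] by (intro PiM_cong) (auto simp: noise_law_def)
      qed
      finally show "distr (noise_law n sd) (PiM {..<n} (\<lambda>_. borel)) (\<lambda>x. \<lambda>i\<in>{..<n}. x i)
        = PiM {..<n} (\<lambda>i. distr (noise_law n sd) borel (\<lambda>x. x i))" .
    qed (use False in \<open>auto simp: I_def\<close>)
    then have "P.indep_vars (\<lambda>_. borel) (\<lambda>i x. x i) I"
      by (rule P.indep_vars_subset) (auto simp: I_def)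
    then have ind: "P.indep_vars (\<lambda>_. borel) (\<lambda>i x. u i * x i) I"
      by (rule P.indep_vars_compose2[where Y = "\<lambda>i x. u i * x"]) auto
    have "distributed (noise_law n sd) lborel (\<lambda>x. \<Sum>i\<in>I. u i * x i)
      (normal_density (\<Sum>i\<in>I. 0) (sqrt (\<Sum>i\<in>I. (\<bar>u i\<bar> * sd)^2)))"
    proof (rule P.sum_indep_normal[OF _ False ind])
      fix i assume "i \<in> I"
      then show "distributed (noise_law n sd) lborel (\<lambda>x. u i * x i) (normal_density 0 (\<bar>u i\<bar> * sd))"
        using P.normal_density_affine[OF coord[of i] sd, of "u i" 0] by (simp add: I_def)
    qed (auto simp: I_def sd)
    moreover have "(\<Sum>i\<in>I. (\<bar>u i\<bar> * sd)^2) = sd^2 * (\<Sum>i\<in>I. (u i)^2)"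
      by (simp add: power_mult_distrib sum_distrib_left mult.commute)
    ultimately have "distr (noise_law n sd) lborel (\<lambda>x. \<Sum>i\<in>I. u i * x i)
      = density lborel (normal_density 0 (sqrt (sd^2 * (\<Sum>i\<in>I. (u i)^2))))"
      by (simp add: distributed_def)
    moreover have "distr (noise_law n sd) lborel (\<lambda>x. \<Sum>i\<in>I. u i * x i)
      = distr (noise_law n sd) borel (\<lambda>x. \<Sum>i\<in>I. u i * x i)"
      by (intro distr_cong) auto
    moreover have "0 < sd^2 * (\<Sum>i\<in>I. (u i)^2)"
      using False sd by (intro mult_pos_pos sum_pos) (auto simp: I_def)
    ultimately show ?thesis
      unfolding sumI sumI2 by (simp add: normal_law_def)
  qed
qed

text \<open>Completing the square: for \<open>x > t\<close> one has
  \<open>x^2 \<ge> t^2 + (x - t)^2\<close>, so the centred density is at most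
  \<open>exp (- t^2 / (2 v))\<close> times the density with mean \<open>t\<close>, whose total mass
  is 1. The left tail uses mean \<open>- t\<close>.\<close>

lemma normal_law_tail:
  assumes t: "0 \<le> t" and V: "0 < V" "v \<le> V"
  shows "measure (normal_law v) {x. t < \<bar>x\<bar>} \<le> 2 * exp (- (t^2) / (2 * V))"
proof (cases "v \<le> 0")
  case True
  then have "measure (normal_law v) {x. t < \<bar>x\<bar>} = 0"
    using t by (simp add: normal_law_def measure_return)
  then show ?thesis by simp
next
  case False
  define s where "s = sqrt v"
  have s: "0 < s" "s^2 = v" using False by (auto simp: s_def)
  interpret N: prob_space "density lborel (normal_density 0 s)"
    by (rule prob_space_normal_density[OF s(1)])
  have side: "emeasure (density lborel (normal_density 0 s)) A \<le> ennreal (exp (- (t^2) / (2 * v)))"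
    if A [measurable]: "A \<in> sets borel" and le: "\<And>x. x \<in> A \<Longrightarrow> t^2 + (x - m)^2 \<le> x^2" for A m
  proof -
    have "emeasure (density lborel (normal_density 0 s)) A
      = (\<integral>\<^sup>+x. ennreal (normal_density 0 s x) * indicator A x \<partial>lborel)"
      by (rule emeasure_density) auto
    also have "\<dots> \<le> (\<integral>\<^sup>+x. ennreal (exp (- (t^2) / (2 * v))) * ennreal (normal_density m s x) \<partial>lborel)"
    proof (rule nn_integral_mono)
      fix x :: real
      show "ennreal (normal_density 0 s x) * indicator A x
        \<le> ennreal (exp (- (t^2) / (2 * v))) * ennreal (normal_density m s x)"
      proof (cases "x \<in> A")
        case True
        have "exp (- (x^2) / (2 * v)) \<le> exp (- (t^2) / (2 * v) + - ((x - m)^2) / (2 * v))"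
          using le[OF True] False by (simp add: field_simps)
        then have "normal_density 0 s x \<le> exp (- (t^2) / (2 * v)) * normal_density m s x"
          unfolding normal_density_def s(2) using s(1) False
          by (simp add: exp_add[symmetric] divide_right_mono)
        then show ?thesis
          using True by (simp add: ennreal_mult[symmetric] ennreal_leI)
      qed simp
    qed
    also have "\<dots> = ennreal (exp (- (t^2) / (2 * v))) * (\<integral>\<^sup>+x. ennreal (normal_density m s x) \<partial>lborel)"
      by (rule nn_integral_cmult) simp
    also have "(\<integral>\<^sup>+x. ennreal (normal_density m s x) \<partial>lborel) = 1"
      using prob_space.emeasure_space_1[OF prob_space_normal_density[OF s(1), of m]]
      by (simp add: emeasure_density)
    finally show ?thesis by simp
  qed
  have "N.prob {x. t < \<bar>x\<bar>} \<le> N.prob ({x. t < x} \<union> {x. x < - t})"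
    by (intro N.finite_measure_mono) auto
  also have "\<dots> \<le> N.prob {x. t < x} + N.prob {x. x < - t}"
    by (intro measure_Un_le) auto
  also have "N.prob {x. t < x} \<le> exp (- (t^2) / (2 * v))"
  proof -
    have "t^2 + (x - t)^2 \<le> x^2" if "t < x" for x
    proof -
      have "t * t \<le> t * x" using that t by (intro mult_left_mono) auto
      then show ?thesis by (simp add: power2_eq_square algebra_simps)
    qed
    then show ?thesis
      using side[of "{x. t < x}" t] by (simp add: N.emeasure_eq_measure)
  qed
  also have "N.prob {x. x < - t} \<le> exp (- (t^2) / (2 * v))"
  proof -
    have "t^2 + (x - (- t))^2 \<le> x^2" if "x < - t" for x
    proof -
      have "t * t \<le> t * (- x)" using that t by (intro mult_left_mono) auto
      then show ?thesis by (simp add: power2_eq_square algebra_simps)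
    qed
    then show ?thesis
      using side[of "{x. x < - t}" "- t"] by (simp add: N.emeasure_eq_measure)
  qed
  finally have "N.prob {x. t < \<bar>x\<bar>} \<le> 2 * exp (- (t^2) / (2 * v))" by simp
  also have "\<dots> \<le> 2 * exp (- (t^2) / (2 * V))"
    using V False by (simp add: frac_le)
  finally show ?thesis
    using False by (simp add: normal_law_def s_def)
qed

section \<open>Conditional law given the design\<close>

lemma distributed_normal_iid_distr:
  fixes sigma :: real
  assumes sigma: "0 < sigma"
    and noise: "distributed M (PiM {..<n} (\<lambda>_. lborel)) E
      (\<lambda>x. ennreal (\<Prod>i<n. normal_density 0 sigma (x i)))"
  shows "distr M (PiM {..<n} (\<lambda>_. borel)) E = noise_law n sigma"
proof -
  have "distr M (PiM {..<n} (\<lambda>_. borel)) E = distr M (PiM {..<n} (\<lambda>_. lborel)) E"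
    by (intro distr_cong sets_PiM_cong) auto
  also have "\<dots> = density (PiM {..<n} (\<lambda>_. lborel)) (\<lambda>x. ennreal (\<Prod>i<n. normal_density 0 sigma (x i)))"
    using noise by (simp add: distributed_def)
  also have "\<dots> = density (PiM {..<n} (\<lambda>_. lborel)) (\<lambda>x. \<Prod>i<n. ennreal (normal_density 0 sigma (x i)))"
    by (simp add: prod_ennreal)
  also have "\<dots> = noise_law n sigma"
    unfolding noise_law_def
    by (intro PiM_density prob_space_normal_density sigma) auto
  finally show ?thesis .
qed

text \<open>One experiment of the sequence. Only the first \<open>n\<close> noise coordinates have a
  prescribed law, hence the restriction.\<close>

locale gaussian_noise = prob_space M for M :: "'a measure" +
  fixes n :: nat and X :: "'a \<Rightarrow> nat \<Rightarrow> nat \<Rightarrow> real" and e :: "'a \<Rightarrow> nat \<Rightarrow> real" and sigma :: real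
  assumes X_measurable [measurable]: "X \<in> measurable M matM"
    and sigma_pos: "0 < sigma"
    and noise: "distributed M (PiM {..<n} (\<lambda>_. lborel))
        (\<lambda>\<omega>. restrict (e \<omega>) {..<n}) (\<lambda>x. ennreal (\<Prod>i<n. normal_density 0 sigma (x i)))"
    and indep: "indep_set {X -` Bx \<inter> space M | Bx. Bx \<in> sets matM}
        {(\<lambda>\<omega>. restrict (e \<omega>) {..<n}) -` Ee \<inter> space M | Ee. Ee \<in> sets (PiM {..<n} (\<lambda>_. (borel :: real measure)))}"
begin

abbreviation "E \<equiv> (\<lambda>\<omega>. restrict (e \<omega>) {..<n})"
abbreviation "D \<equiv> noise_law n sigma"

lemma E_measurable [measurable]: "E \<in> measurable M (PiM {..<n} (\<lambda>_. borel))"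
proof -
  have "E \<in> measurable M (PiM {..<n} (\<lambda>_. lborel))"
    using noise by (simp add: distributed_def)
  also have "measurable M (PiM {..<n} (\<lambda>_. lborel)) = measurable M (PiM {..<n} (\<lambda>_. borel :: real measure))"
    by (intro measurable_cong_sets sets_PiM_cong) auto
  finally show ?thesis .
qed

lemma prob_space_D: "prob_space D"
  unfolding distributed_normal_iid_distr[OF sigma_pos noise, symmetric]
  by (rule prob_space_distr) measurable

lemma joint_distr:
  "distr M (matM \<Otimes>\<^sub>M PiM {..<n} (\<lambda>_. borel)) (\<lambda>\<omega>. (X \<omega>, E \<omega>)) = distr M matM X \<Otimes>\<^sub>M D"
proof -
  let ?Q = "PiM {..<n} (\<lambda>_. borel :: real measure)"
  interpret D: prob_space D by (rule prob_space_D)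
  interpret P: prob_space "distr M matM X" by (rule prob_space_distr) measurable
  have pair [measurable]: "(\<lambda>\<omega>. (X \<omega>, E \<omega>)) \<in> measurable M (matM \<Otimes>\<^sub>M ?Q)" by measurable
  have "distr M matM X \<Otimes>\<^sub>M D = distr M (matM \<Otimes>\<^sub>M ?Q) (\<lambda>\<omega>. (X \<omega>, E \<omega>))"
  proof (rule pair_measure_eqI)
    show "sigma_finite_measure (distr M matM X)" "sigma_finite_measure D" by unfold_locales
    show "sets (distr M matM X \<Otimes>\<^sub>M D) = sets (distr M (matM \<Otimes>\<^sub>M ?Q) (\<lambda>\<omega>. (X \<omega>, E \<omega>)))"
      unfolding sets_distr by (intro sets_pair_measure_cong) (auto simp: noise_law_sets)
    fix A B assume "A \<in> sets (distr M matM X)" "B \<in> sets D"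
    then have A: "A \<in> sets matM" and B: "B \<in> sets ?Q" by (auto simp: noise_law_sets)
    have "emeasure (distr M matM X) A * emeasure D B
        = ennreal (prob (X -` A \<inter> space M) * prob (E -` B \<inter> space M))"
      unfolding distributed_normal_iid_distr[OF sigma_pos noise, symmetric]
        emeasure_distr[OF X_measurable A] emeasure_distr[OF E_measurable B]
      by (simp add: emeasure_eq_measure ennreal_mult)
    also have "prob (X -` A \<inter> space M) * prob (E -` B \<inter> space M)
        = prob ((X -` A \<inter> space M) \<inter> (E -` B \<inter> space M))"
      using A B by (intro indep_setD[OF indep, symmetric]) auto
    also have "(X -` A \<inter> space M) \<inter> (E -` B \<inter> space M) = (\<lambda>\<omega>. (X \<omega>, E \<omega>)) -` (A \<times> B) \<inter> space M"
      by auto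
    also have "ennreal (prob \<dots>) = emeasure (distr M (matM \<Otimes>\<^sub>M ?Q) (\<lambda>\<omega>. (X \<omega>, E \<omega>))) (A \<times> B)"
      using A B by (subst emeasure_distr[OF pair]) (auto simp: emeasure_eq_measure)
    finally show "emeasure (distr M matM X) A * emeasure D B
        = emeasure (distr M (matM \<Otimes>\<^sub>M ?Q) (\<lambda>\<omega>. (X \<omega>, E \<omega>))) (A \<times> B)" .
  qed
  then show ?thesis by simp
qed

section \<open>Linear forms in the noise with coefficients depending on the design\<close>

context
  fixes u :: "nat \<Rightarrow> (nat \<Rightarrow> nat \<Rightarrow> real) \<Rightarrow> real" and A :: "real set"
  assumes u [measurable]: "\<And>i. i < n \<Longrightarrow> u i \<in> borel_measurable matM"
    and A [measurable]: "A \<in> sets borel"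
begin

lemma linear_form_pair_measurable [measurable]:
  "(\<lambda>w. \<Sum>i<n. u i (fst w) * snd w i) \<in> borel_measurable (matM \<Otimes>\<^sub>M PiM {..<n} (\<lambda>_. borel))"
  by (intro borel_measurable_sum borel_measurable_times measurable_compose[OF measurable_fst u]
      measurable_compose[OF measurable_snd measurable_component_singleton]) auto

lemma linear_form_measurable [measurable]: "(\<lambda>\<omega>. \<Sum>i<n. u i (X \<omega>) * e \<omega> i) \<in> borel_measurable M"
proof -
  have "(\<lambda>\<omega>. (X \<omega>, E \<omega>)) \<in> measurable M (matM \<Otimes>\<^sub>M PiM {..<n} (\<lambda>_. borel))" by measurable
  from measurable_compose[OF this linear_form_pair_measurable] show ?thesis by simp
qed

abbreviation (input) "law_at x \<equiv> measure (normal_law (sigma^2 * (\<Sum>i<n. (u i x)^2))) A"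

lemma emeasure_noise_slice:
  assumes "x \<in> space matM"
  shows "emeasure D (Pair x -` {w \<in> space (matM \<Otimes>\<^sub>M PiM {..<n} (\<lambda>_. borel)).
      fst w \<in> B \<and> (\<Sum>i<n. u i (fst w) * snd w i) \<in> A}) = ennreal (indicator B x * law_at x)"
proof (cases "x \<in> B")
  case True
  interpret N: prob_space "normal_law (sigma^2 * (\<Sum>i<n. (u i x)^2))" by (rule normal_law_prob)
  have sp: "space D = space (PiM {..<n} (\<lambda>_. borel :: real measure))"
    by (rule sets_eq_imp_space_eq[OF noise_law_sets])
  have lin: "(\<lambda>y. \<Sum>i<n. u i x * y i) \<in> borel_measurable D"
    unfolding measurable_cong_sets[OF noise_law_sets refl]
    by (intro borel_measurable_sum borel_measurable_times measurable_component_singleton) auto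
  have "Pair x -` {w \<in> space (matM \<Otimes>\<^sub>M PiM {..<n} (\<lambda>_. borel)).
      fst w \<in> B \<and> (\<Sum>i<n. u i (fst w) * snd w i) \<in> A} = (\<lambda>y. \<Sum>i<n. u i x * y i) -` A \<inter> space D"
    using True assms by (auto simp: space_pair_measure sp)
  also have "emeasure D \<dots> = emeasure (distr D borel (\<lambda>y. \<Sum>i<n. u i x * y i)) A"
    by (rule emeasure_distr[symmetric, OF lin A])
  finally show ?thesis
    using True by (simp add: noise_law_linear_form[OF sigma_pos] N.emeasure_eq_measure)
next
  case False
  then show ?thesis by simp
qed

text \<open>The normal probability is a slice measure of a measurable set in the product space, so
  its measurability in the design comes with Fubini's theorem.\<close>

lemma law_at_measurable: 
  assumes [measurable]: "B \<in> sets matM"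
  shows "(\<lambda>x. ennreal (indicator B x * law_at x)) \<in> borel_measurable matM"
proof -
  interpret D: prob_space D by (rule prob_space_D)
  let ?T = "{w \<in> space (matM \<Otimes>\<^sub>M PiM {..<n} (\<lambda>_. borel)).
      fst w \<in> B \<and> (\<Sum>i<n. u i (fst w) * snd w i) \<in> A}"
  have "?T \<in> sets (matM \<Otimes>\<^sub>M PiM {..<n} (\<lambda>_. borel))" by measurable
  also have "sets (matM \<Otimes>\<^sub>M PiM {..<n} (\<lambda>_. borel)) = sets (matM \<Otimes>\<^sub>M D)"
    by (intro sets_pair_measure_cong) (auto simp: noise_law_sets)
  finally have "(\<lambda>x. emeasure D (Pair x -` ?T)) \<in> borel_measurable matM"
    by (rule D.measurable_emeasure_Pair)
  then show ?thesis
    by (rule measurable_cong[THEN iffD1, rotated]) (rule emeasure_noise_slice)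
qed

lemma law_at_bounds: "0 \<le> law_at x" "law_at x \<le> 1"
  using prob_space.prob_le_1[OF normal_law_prob] by auto

lemma law_at_integrable:
  assumes B: "B \<in> sets matM"
  shows "(\<lambda>\<omega>. indicator B (X \<omega>) * law_at (X \<omega>)) \<in> borel_measurable M"
    and "integrable M (\<lambda>\<omega>. indicator B (X \<omega>) * law_at (X \<omega>))"
proof -
  have "(\<lambda>\<omega>. enn2real (ennreal (indicator B (X \<omega>) * law_at (X \<omega>)))) \<in> borel_measurable M"
    by (intro borel_measurable_enn2real measurable_compose[OF X_measurable law_at_measurable[OF B]])
  then show *: "(\<lambda>\<omega>. indicator B (X \<omega>) * law_at (X \<omega>)) \<in> borel_measurable M"
    by simp
  show "integrable M (\<lambda>\<omega>. indicator B (X \<omega>) * law_at (X \<omega>))"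
    by (rule integrable_const_bound[OF _ *, of 1]) (auto simp: indicator_def law_at_bounds)
qed

text \<open>By independence the joint law is a product; integrating out the noise first leaves
  coefficients frozen at the design. Used twice: with a column of the design as coefficients for the
  noise bound, and with the fit of \<open>Theta_hat\<close> for \<open>W1\<close>.\<close>

lemma conditional_normal_law:
  assumes B [measurable]: "B \<in> sets matM"
  shows "prob {\<omega>\<in>space M. X \<omega> \<in> B \<and> (\<Sum>i<n. u i (X \<omega>) * e \<omega> i) \<in> A}
    = (\<integral>\<omega>. indicator B (X \<omega>) * law_at (X \<omega>) \<partial>M)"
proof -
  interpret D: prob_space D by (rule prob_space_D)
  let ?Q = "matM \<Otimes>\<^sub>M PiM {..<n} (\<lambda>_. borel)"
  let ?T = "{w \<in> space ?Q. fst w \<in> B \<and> (\<Sum>i<n. u i (fst w) * snd w i) \<in> A}"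
  have T: "?T \<in> sets ?Q" by measurable
  have pair: "(\<lambda>\<omega>. (X \<omega>, E \<omega>)) \<in> measurable M ?Q" by measurable
  have "{\<omega>\<in>space M. X \<omega> \<in> B \<and> (\<Sum>i<n. u i (X \<omega>) * e \<omega> i) \<in> A} = (\<lambda>\<omega>. (X \<omega>, E \<omega>)) -` ?T \<inter> space M"
    using measurable_space[OF pair] by auto
  then have "emeasure M {\<omega>\<in>space M. X \<omega> \<in> B \<and> (\<Sum>i<n. u i (X \<omega>) * e \<omega> i) \<in> A}
      = emeasure (distr M ?Q (\<lambda>\<omega>. (X \<omega>, E \<omega>))) ?T"
    using emeasure_distr[OF pair T] by simp
  also have "\<dots> = emeasure (distr M matM X \<Otimes>\<^sub>M D) ?T"
    by (simp only: joint_distr)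
  also have "\<dots> = (\<integral>\<^sup>+x. emeasure D (Pair x -` ?T) \<partial>distr M matM X)"
  proof (rule D.emeasure_pair_measure_alt)
    have "sets ?Q = sets (distr M matM X \<Otimes>\<^sub>M D)"
      by (intro sets_pair_measure_cong) (auto simp: noise_law_sets)
    with T show "?T \<in> sets (distr M matM X \<Otimes>\<^sub>M D)" by simp
  qed
  also have "\<dots> = (\<integral>\<^sup>+x. ennreal (indicator B x * law_at x) \<partial>distr M matM X)"
    by (intro nn_integral_cong emeasure_noise_slice) simp
  also have "\<dots> = (\<integral>\<^sup>+\<omega>. ennreal (indicator B (X \<omega>) * law_at (X \<omega>)) \<partial>M)"
    by (rule nn_integral_distr[OF X_measurable]) (subst measurable_distr_eq1, rule law_at_measurable[OF B])
  also have "\<dots> = ennreal (\<integral>\<omega>. indicator B (X \<omega>) * law_at (X \<omega>) \<partial>M)"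
    by (rule nn_integral_eq_integral[OF law_at_integrable(2)[OF B]]) (simp add: law_at_bounds)
  finally show ?thesis
    by (simp add: emeasure_eq_measure integral_nonneg_AE law_at_bounds)
qed

end

text \<open>Given the design, each correlation is normal with variance at most
  \<open>sigma^2 * V\<close> wherever the column bound holds; a union bound over the columns
  follows. Placing the column bound inside the event avoids conditioning on it.\<close>

lemma noise_correlation_tail:
  fixes p :: nat
  assumes t: "0 \<le> t" and V: "0 < V"
  defines "bad \<equiv> {\<omega>\<in>space M. \<exists>j<p. (\<Sum>i<n. (X \<omega> i j)^2) \<le> V \<and> t < \<bar>\<Sum>i<n. X \<omega> i j * e \<omega> i\<bar>}"
  shows "bad \<in> sets M" "prob bad \<le> real p * (2 * exp (- (t^2) / (2 * (sigma^2 * V))))"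
proof -
  define B where "B j = {x\<in>space matM. (\<Sum>i<n. (x i j)^2) \<le> V}" for j
  have B [measurable]: "B j \<in> sets matM" for j unfolding B_def by measurable
  define T where "T = {x::real. t < \<bar>x\<bar>}"
  have T [measurable]: "T \<in> sets borel" unfolding T_def by measurable
  define bad1 where "bad1 j = {\<omega>\<in>space M. X \<omega> \<in> B j \<and> (\<Sum>i<n. X \<omega> i j * e \<omega> i) \<in> T}" for j
  have lin [measurable]: "(\<lambda>\<omega>. \<Sum>i<n. X \<omega> i j * e \<omega> i) \<in> borel_measurable M" for j
    by (rule linear_form_measurable[of "\<lambda>i x. x i j"]) measurable
  have bad1 [measurable]: "bad1 j \<in> sets M" for j unfolding bad1_def by measurable
  have eq: "bad = (\<Union>j<p. bad1 j)"
    using measurable_space[OF X_measurable] by (auto simp: bad_def bad1_def B_def T_def)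
  show "bad \<in> sets M" unfolding eq by measurable
  have "prob (bad1 j) \<le> 2 * exp (- (t^2) / (2 * (sigma^2 * V)))" for j
  proof -
    have "prob (bad1 j) = (\<integral>\<omega>. indicator (B j) (X \<omega>)
        * measure (normal_law (sigma^2 * (\<Sum>i<n. (X \<omega> i j)^2))) T \<partial>M)"
      unfolding bad1_def by (rule conditional_normal_law[of "\<lambda>i x. x i j"]) measurable
    also have "\<dots> \<le> 2 * exp (- (t^2) / (2 * (sigma^2 * V)))"
    proof (rule integral_le_const)
      show "integrable M (\<lambda>\<omega>. indicator (B j) (X \<omega>) * measure (normal_law (sigma^2 * (\<Sum>i<n. (X \<omega> i j)^2))) T)"
        by (rule law_at_integrable[of "\<lambda>i x. x i j"]) measurable
      have "measure (normal_law (sigma^2 * (\<Sum>i<n. (X \<omega> i j)^2))) T \<le> 2 * exp (- (t^2) / (2 * (sigma^2 * V)))"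
        if "X \<omega> \<in> B j" for \<omega>
        unfolding T_def using that sigma_pos V
        by (intro normal_law_tail t mult_left_mono) (auto simp: B_def)
      then show "AE \<omega> in M. indicator (B j) (X \<omega>) * measure (normal_law (sigma^2 * (\<Sum>i<n. (X \<omega> i j)^2))) T
          \<le> 2 * exp (- (t^2) / (2 * (sigma^2 * V)))"
        by (intro AE_I2) (auto simp: indicator_def)
    qed
    finally show ?thesis .
  qed
  then have "(\<Sum>j<p. prob (bad1 j)) \<le> real p * (2 * exp (- (t^2) / (2 * (sigma^2 * V))))"
    using sum_bounded_above[of "{..<p}" "\<lambda>j. prob (bad1 j)"] by simp
  moreover have "prob bad \<le> (\<Sum>j<p. prob (bad1 j))"
    unfolding eq by (intro finite_measure_subadditive_finite) auto
  ultimately show "prob bad \<le> real p * (2 * exp (- (t^2) / (2 * (sigma^2 * V))))" by simp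
qed

end

section \<open>Asymptotics\<close>

text \<open>The measurable sub-events are intersected, each spending half of the error
  budget.\<close>

lemma whp_conj:
  assumes prob: "\<And>k. prob_space (M k)" and P: "whp M P" and Q: "whp M Q"
  shows "whp M (\<lambda>k \<omega>. P k \<omega> \<and> Q k \<omega>)"
  unfolding whp_def
proof (intro allI impI)
  fix d :: real assume "0 < d"
  then have "\<forall>\<^sub>F k in sequentially. \<exists>E\<in>sets (M k). E \<subseteq> {\<omega>\<in>space (M k). P k \<omega>} \<and> measure (M k) E \<ge> 1 - d / 2"
    "\<forall>\<^sub>F k in sequentially. \<exists>E\<in>sets (M k). E \<subseteq> {\<omega>\<in>space (M k). Q k \<omega>} \<and> measure (M k) E \<ge> 1 - d / 2"
    using P Q by (simp_all add: whp_def)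
  then show "\<forall>\<^sub>F k in sequentially. \<exists>E\<in>sets (M k). E \<subseteq> {\<omega>\<in>space (M k). P k \<omega> \<and> Q k \<omega>} \<and> measure (M k) E \<ge> 1 - d"
  proof eventually_elim
    case (elim k)
    interpret prob_space "M k" by (rule prob)
    obtain E F where E: "E \<in> events" "E \<subseteq> {\<omega>\<in>space (M k). P k \<omega>}" "1 - d / 2 \<le> prob E"
      and F: "F \<in> events" "F \<subseteq> {\<omega>\<in>space (M k). Q k \<omega>}" "1 - d / 2 \<le> prob F"
      using elim by blast
    have "prob (space (M k) - (E \<inter> F)) \<le> prob ((space (M k) - E) \<union> (space (M k) - F))"
      using E(1) F(1) by (intro finite_measure_mono) auto
    also have "\<dots> \<le> prob (space (M k) - E) + prob (space (M k) - F)"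
      using E(1) F(1) by (intro measure_Un_le) auto
    finally have "1 - d \<le> prob (E \<inter> F)"
      using E F by (simp add: prob_compl)
    then show ?case using E F by (intro bexI[of _ "E \<inter> F"]) auto
  qed
qed

lemma whp_mono:
  assumes P: "whp M P" and PQ: "\<forall>\<^sub>F k in sequentially. \<forall>\<omega>\<in>space (M k). P k \<omega> \<longrightarrow> Q k \<omega>"
  shows "whp M Q"
  unfolding whp_def
proof (intro allI impI)
  fix d :: real assume "0 < d"
  then have "\<forall>\<^sub>F k in sequentially. \<exists>E\<in>sets (M k). E \<subseteq> {\<omega>\<in>space (M k). P k \<omega>} \<and> measure (M k) E \<ge> 1 - d"
    using P by (simp add: whp_def)
  with PQ show "\<forall>\<^sub>F k in sequentially. \<exists>E\<in>sets (M k). E \<subseteq> {\<omega>\<in>space (M k). Q k \<omega>} \<and> measure (M k) E \<ge> 1 - d"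
    by eventually_elim blast
qed

lemma whp_complement:
  assumes prob: "\<And>k. prob_space (M k)"
    and bad: "\<forall>\<^sub>F k in sequentially. {\<omega>\<in>space (M k). \<not> P k \<omega>} \<in> sets (M k) \<and>
      measure (M k) {\<omega>\<in>space (M k). \<not> P k \<omega>} \<le> a k"
    and a: "a \<longlonglongrightarrow> 0"
  shows "whp M P"
  unfolding whp_def
proof (intro allI impI)
  fix d :: real assume "0 < d"
  then have "\<forall>\<^sub>F k in sequentially. a k < d" using a by (simp add: order_tendstoD)
  with bad show "\<forall>\<^sub>F k in sequentially. \<exists>E\<in>sets (M k). E \<subseteq> {\<omega>\<in>space (M k). P k \<omega>} \<and> measure (M k) E \<ge> 1 - d"
  proof eventually_elim
    case (elim k)
    interpret prob_space "M k" by (rule prob)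
    let ?bad = "{\<omega>\<in>space (M k). \<not> P k \<omega>}"
    have "1 - d \<le> prob (space (M k) - ?bad)" using elim by (simp add: prob_compl)
    then show ?case using elim by (intro bexI[of _ "space (M k) - ?bad"]) auto
  qed
qed

lemma whp_imp_bounded_in_prob: "whp M (\<lambda>k \<omega>. \<bar>Z k \<omega>\<bar> \<le> C) \<Longrightarrow> bounded_in_prob M Z"
  unfolding whp_def bounded_in_prob_def by blast

section \<open>Tuning parameters and limits\<close>

theorem theorem1:
  fixes M :: "nat \<Rightarrow> 'a measure"
    and n p :: "nat \<Rightarrow> nat"
    and X :: "nat \<Rightarrow> 'a \<Rightarrow> nat \<Rightarrow> nat \<Rightarrow> real"
    and eps :: "nat \<Rightarrow> 'a \<Rightarrow> nat \<Rightarrow> real"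
    and beta0 :: "nat \<Rightarrow> nat \<Rightarrow> real"
    and sigma :: real
  defines "Y \<equiv> (\<lambda>k \<omega> i. mv (p k) (X k \<omega>) (beta0 k) i + eps k \<omega> i)"
    and "s0 \<equiv> (\<lambda>k. l0norm (p k) (beta0 k))"
  assumes prob: "\<And>k. prob_space (M k)"
    and n_lim: "filterlim n at_top sequentially"
    and p_gt_n: "\<And>k. n k < p k"
    and X_dims: "\<And>k \<omega> i j. n k \<le> i \<or> p k \<le> j \<Longrightarrow> X k \<omega> i j = 0"
    and X_mean0: "\<And>k i j. i < n k \<Longrightarrow> j < p k \<Longrightarrow>
        integrable (M k) (\<lambda>\<omega>. X k \<omega> i j) \<and> (\<integral>\<omega>. X k \<omega> i j \<partial>M k) = 0"
    and X_second: "\<And>k i j l. i < n k \<Longrightarrow> j < p k \<Longrightarrow> l < p k \<Longrightarrow>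
        integrable (M k) (\<lambda>\<omega>. X k \<omega> i j * X k \<omega> i l)"
    and Sigma_pd: "\<And>k v. (\<forall>j\<ge>p k. v j = 0) \<Longrightarrow> (\<exists>j<p k. v j \<noteq> 0) \<Longrightarrow>
        0 < (\<Sum>j<p k. \<Sum>l<p k. v j *
               ((\<Sum>i<n k. \<integral>\<omega>. X k \<omega> i j * X k \<omega> i l \<partial>M k) / real (n k)) * v l)"
    and beta0_dim: "\<And>k j. p k \<le> j \<Longrightarrow> beta0 k j = 0"
    and sigma_pos: "sigma > 0"
    and noise: "\<And>k. distributed (M k) (PiM {..<n k} (\<lambda>_. lborel))
        (\<lambda>\<omega>. restrict (eps k \<omega>) {..<n k}) (\<lambda>x. ennreal (\<Prod>i<n k. normal_density 0 sigma (x i)))"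
    and X_meas: "\<And>k. X k \<in> measurable (M k) matM"
    and indep: "\<And>k. prob_space.indep_set (M k)
        {X k -` Bx \<inter> space (M k) | Bx. Bx \<in> sets matM}
        {(\<lambda>\<omega>. restrict (eps k \<omega>) {..<n k}) -` Ee \<inter> space (M k) | Ee.
           Ee \<in> sets (PiM {..<n k} (\<lambda>_. (borel :: real measure)))}"
    and A1: "\<And>k. AE \<omega> in M k. general_position (n k) (p k) (X k \<omega>)"
    and A2: "\<exists>Cmin K. Cmin > 0 \<and> K > 0 \<and> (\<forall>k. K dvd n k) \<and>
        whp M (\<lambda>k \<omega>. phi_min (n k) (p k) (X k \<omega>) (n k div K) \<ge> Cmin)"
    and A3: "\<exists>Cmax > 0. whp M (\<lambda>k \<omega>. phi_max (n k) (p k) (X k \<omega>) (n k) \<le> Cmax)"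
    and A4i: "\<exists>Cstar > 0. \<exists>B. \<forall>\<^sub>F k in sequentially. \<exists>E\<in>sets (M k).
        E \<subseteq> {\<omega>\<in>space (M k). phi_max (n k) (p k) (X k \<omega>) 1 \<le> Cstar} \<and>
        measure (M k) E \<ge> 1 - B / real (p k)"
    and A4ii: "\<exists>kmin > 0. whp M (\<lambda>k \<omega>. kappa_sq (n k) (p k) (X k \<omega>) (s0 k) 3 \<ge> kmin^2)"
    and sparsity: "(\<lambda>k. real (s0 k)) \<in> o(\<lambda>k. sqrt (real (n k) / ln (real (p k))))"
  shows "\<exists>lam0 lam1 :: nat \<Rightarrow> real.
     (\<exists>c1 c2. 0 < c1 \<and> c1 \<le> c2 \<and> (\<forall>\<^sub>F k in sequentially.
        c1 \<le> lam0 k / sqrt (ln (real (p k)) / real (n k)) \<and>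
        lam0 k / sqrt (ln (real (p k)) / real (n k)) \<le> c2)) \<and>
     (\<exists>c1 c2. 0 < c1 \<and> c1 \<le> c2 \<and> (\<forall>\<^sub>F k in sequentially.
        c1 \<le> lam1 k / (1 / sqrt (real (n k))) \<and> lam1 k / (1 / sqrt (real (n k))) \<le> c2)) \<and>
     (\<forall>k. \<forall>\<omega>\<in>space (M k).
        sqrt (real (n k)) * (debiased1 (n k) (p k) (X k \<omega>) (Y k \<omega>) (lam0 k) (lam1 k) - beta0 k 0)
        = W1 (n k) (p k) (X k \<omega>) (eps k \<omega>) (lam1 k)
          + Delta1 (n k) (p k) (X k \<omega>) (Y k \<omega>) (beta0 k) (lam0 k) (lam1 k)) \<and>
     (\<forall>k. \<forall>A\<in>sets (borel :: real measure). \<forall>Bx\<in>sets matM.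
        measure (completion (M k))
          {\<omega>\<in>space (M k). X k \<omega> \<in> Bx \<and> W1 (n k) (p k) (X k \<omega>) (eps k \<omega>) (lam1 k) \<in> A}
        = (\<integral>\<omega>. indicator Bx (X k \<omega>) *
             measure (normal_law (sigma^2 * Omega_hat (n k) (p k) (X k \<omega>) (lam1 k))) A
           \<partial>completion (M k))) \<and>
     bounded_in_prob M (\<lambda>k \<omega>. Omega_hat (n k) (p k) (X k \<omega>) (lam1 k)) \<and>
     small_in_prob M (\<lambda>k \<omega>. Delta1 (n k) (p k) (X k \<omega>) (Y k \<omega>) (beta0 k) (lam0 k) (lam1 k))"
proof -
  obtain Cmin K where Cmin: "0 < Cmin" and K: "0 < K" "\<And>k. K dvd n k"
    and whp_min: "whp M (\<lambda>k \<omega>. phi_min (n k) (p k) (X k \<omega>) (n k div K) \<ge> Cmin)"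
    using A2 by blast
  obtain Cmax where Cmax: "0 < Cmax" and whp_max: "whp M (\<lambda>k \<omega>. phi_max (n k) (p k) (X k \<omega>) (n k) \<le> Cmax)"
    using A3 by blast
  obtain kmin where kmin: "0 < kmin" and whp_kappa: "whp M (\<lambda>k \<omega>. kappa_sq (n k) (p k) (X k \<omega>) (s0 k) 3 \<ge> kmin^2)"
    using A4ii by blast
  \<comment> \<open>\<open>a\<close> makes the Gaussian tail exponent \<open>2 ln p\<close>, enough for a union bound over \<open>p\<close> columns;
    \<open>c\<close> leaves at most \<open>n / (4K)\<close> active coordinates in the node-wise Lasso.\<close>
  define a where "a = 4 * sigma * sqrt Cmax"
  define c where "c = 2 * Cmax * real K"
  define lam0 where "lam0 k = a * sqrt (ln (real (p k)) / real (n k))" for k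
  define lam1 where "lam1 k = c / sqrt (real (n k))" for k
  have a: "0 < a" "a^2 = 16 * sigma^2 * Cmax"
    using sigma_pos Cmax by (auto simp: a_def power_mult_distrib)
  have c: "0 < c" using Cmax K by (simp add: c_def)
  have p0: "0 < p k" for k using p_gt_n[of k] by simp
  have ev_n: "\<forall>\<^sub>F k in sequentially. N \<le> n k" for N
    using n_lim by (simp add: filterlim_at_top)
  have lnp: "0 < ln (real (p k))" if "0 < n k" for k
    using that p_gt_n[of k] by simp
  have lam0_pos: "0 < lam0 k" if "0 < n k" for k
    using that lnp[OF that] a by (simp add: lam0_def)
  have lam1_pos: "0 < lam1 k" if "0 < n k" for k
    using that c by (simp add: lam1_def)
  have gn: "gaussian_noise (M k) (n k) (X k) (eps k) sigma" for k
    by (intro gaussian_noise.intro gaussian_noise_axioms.intro prob X_meas sigma_pos noise indep)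

  \<comment> \<open>The column bound is a premise here and is discharged later from
    \<open>phi_max\<close>. In this form the event is measurable, whatever is known about the sparse
    eigenvalues.\<close>
  define quiet where "quiet k \<omega> \<longleftrightarrow> (\<forall>j<p k. (\<Sum>i<n k. (X k \<omega> i j)^2) \<le> Cmax * real (n k) \<longrightarrow>
      \<bar>\<Sum>i<n k. X k \<omega> i j * eps k \<omega> i\<bar> / real (n k) \<le> lam0 k / 2)" for k \<omega>
  have whp_quiet: "whp M quiet"
  proof (rule whp_complement[OF prob])
    show "\<forall>\<^sub>F k in sequentially. {\<omega>\<in>space (M k). \<not> quiet k \<omega>} \<in> sets (M k) \<and>
        measure (M k) {\<omega>\<in>space (M k). \<not> quiet k \<omega>} \<le> 2 * inverse (real (p k))"
      using ev_n[of 1]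
    proof eventually_elim
      case (elim k)
      then have nk: "0 < n k" by simp
      interpret gaussian_noise "M k" "n k" "X k" "eps k" sigma by (rule gn)
      let ?t = "real (n k) * lam0 k / 2" and ?V = "Cmax * real (n k)"
      let ?bad = "{\<omega>\<in>space (M k). \<exists>j<p k. (\<Sum>i<n k. (X k \<omega> i j)^2) \<le> ?V \<and> ?t < \<bar>\<Sum>i<n k. X k \<omega> i j * eps k \<omega> i\<bar>}"
      have bad: "{\<omega>\<in>space (M k). \<not> quiet k \<omega>} = ?bad"
        using nk by (auto simp: quiet_def not_le field_simps)
      have t0: "0 \<le> ?t" using lam0_pos[OF nk] by simp
      have V0: "0 < ?V" using Cmax nk by simp
      have "?t^2 / (2 * (sigma^2 * ?V)) = 2 * ln (real (p k))"
      proof -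
        have "(lam0 k)^2 = 16 * sigma^2 * Cmax * (ln (real (p k)) / real (n k))"
          using lnp[OF nk] by (simp add: lam0_def power_mult_distrib a)
        then show ?thesis
          using nk sigma_pos Cmax by (simp add: power_divide power_mult_distrib field_simps power2_eq_square)
      qed
      then have "exp (- (?t^2) / (2 * (sigma^2 * ?V))) = inverse (real (p k))^2"
        using p0[of k] by (simp add: exp_minus exp_double power_inverse)
      \<comment> \<open>The \<open>p\<close> columns each contribute \<open>2 / p^2\<close>, so the
        union bound vanishes as \<open>p\<close> grows.\<close>
      then have "real (p k) * (2 * exp (- (?t^2) / (2 * (sigma^2 * ?V)))) = 2 * inverse (real (p k))"
        using p0[of k] by (simp add: power2_eq_square)
      then show ?case
        using noise_correlation_tail[OF t0 V0, of "p k"] unfolding bad by metis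
    qed
    have "filterlim (\<lambda>k. real (p k)) at_top sequentially"
    proof (rule filterlim_at_top_mono)
      show "filterlim (\<lambda>k. real (n k)) at_top sequentially"
        using n_lim by (rule filterlim_compose[OF filterlim_real_sequentially])
    qed (use p_gt_n in \<open>auto intro: always_eventually less_imp_le\<close>)
    then show "(\<lambda>k. 2 * inverse (real (p k))) \<longlonglongrightarrow> 0"
      by (intro tendsto_mult_right_zero tendsto_inverse_0_at_top)
  qed

  \<comment> \<open>The two facts about the estimators that both limits rest on; they follow
    pointwise from the four conditions holding with high probability.\<close>
  define good where "good k \<omega> \<longleftrightarrow> Cmin \<le> tau_tilde_sq (n k) (p k) (X k \<omega>) (lam1 k) \<and>
      (\<Sum>j<p k. \<bar>lasso (n k) (p k) (X k \<omega>) (Y k \<omega>) (lam0 k) j - beta0 k j\<bar>)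
        \<le> 12 * lam0 k * real (s0 k) / kmin^2" for k \<omega>
  have whp_good: "whp M good"
  proof (rule whp_mono[OF whp_conj[OF prob whp_conj[OF prob whp_min whp_max] whp_conj[OF prob whp_kappa whp_quiet]]])
    show "\<forall>\<^sub>F k in sequentially. \<forall>\<omega>\<in>space (M k).
      (Cmin \<le> phi_min (n k) (p k) (X k \<omega>) (n k div K) \<and> phi_max (n k) (p k) (X k \<omega>) (n k) \<le> Cmax) \<and>
      kmin^2 \<le> kappa_sq (n k) (p k) (X k \<omega>) (s0 k) 3 \<and> quiet k \<omega> \<longrightarrow> good k \<omega>"
      using ev_n[of "2 * K"]
    proof eventually_elim
      case (elim k)
      have nk: "0 < n k" using elim K by simp
      have m: "n k = K * (n k div K)" "2 \<le> n k div K"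
        using K elim by (auto simp: less_eq_div_iff_mult_less_eq mult.commute)
      show ?case
      proof (intro ballI impI, elim conjE)
        fix \<omega>
        assume h: "Cmin \<le> phi_min (n k) (p k) (X k \<omega>) (n k div K)"
          "phi_max (n k) (p k) (X k \<omega>) (n k) \<le> Cmax"
          "kmin^2 \<le> kappa_sq (n k) (p k) (X k \<omega>) (s0 k) 3" "quiet k \<omega>"
        have "Cmin \<le> tau_tilde_sq (n k) (p k) (X k \<omega>) (lam1 k)"
          by (rule tau_tilde_sq_ge[OF m(1) K(1) m(2) p_gt_n Cmax h(2) Cmin h(1)]) (simp add: lam1_def c_def)
        moreover have "(\<Sum>j<p k. \<bar>lasso (n k) (p k) (X k \<omega>) (Y k \<omega>) (lam0 k) j - beta0 k j\<bar>)
            \<le> 12 * lam0 k * real (l0norm (p k) (beta0 k)) / kmin^2"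
        proof (rule lasso_l1_error[OF lasso_is_l1_min[OF lam0_pos[OF nk]] lam0_pos[OF nk] nk])
          show "Y k \<omega> i = mv (p k) (X k \<omega>) (beta0 k) i + eps k \<omega> i" for i by (simp add: Y_def)
          show "\<forall>j\<ge>p k. beta0 k j = 0" using beta0_dim by simp
          show "0 < kmin^2" using kmin by simp
          show "kmin^2 \<le> kappa_sq (n k) (p k) (X k \<omega>) (l0norm (p k) (beta0 k)) 3"
            using h(3) by (simp add: s0_def)
          fix j assume j: "j < p k"
          have "sqn (n k) (\<lambda>i. X k \<omega> i j) / real (n k) \<le> Cmax"
            using column_le_phi_max[OF j, of "n k" "n k" "X k \<omega>"] h(2) nk by simp
          then have "(\<Sum>i<n k. (X k \<omega> i j)^2) \<le> Cmax * real (n k)"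
            using nk by (simp add: sqn_def divide_le_eq)
          then show "\<bar>\<Sum>i<n k. X k \<omega> i j * eps k \<omega> i\<bar> / real (n k) \<le> lam0 k / 2"
            using h(4) j by (simp add: quiet_def)
        qed
        ultimately show "good k \<omega>" by (simp add: good_def s0_def)
      qed
    qed
  qed

  have bounded: "bounded_in_prob M (\<lambda>k \<omega>. Omega_hat (n k) (p k) (X k \<omega>) (lam1 k))"
  proof (rule whp_imp_bounded_in_prob, rule whp_mono[OF whp_good])
    show "\<forall>\<^sub>F k in sequentially. \<forall>\<omega>\<in>space (M k). good k \<omega> \<longrightarrow> \<bar>Omega_hat (n k) (p k) (X k \<omega>) (lam1 k)\<bar> \<le> 1 / Cmin"
      using ev_n[of 1]
    proof eventually_elim
      case (elim k)
      then have "0 \<le> lam1 k" using lam1_pos[of k] by simp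
      then show ?case
        using Omega_hat_le[OF p0 _ Cmin] by (auto simp: good_def)
    qed
  qed

  have small: "small_in_prob M (\<lambda>k \<omega>. Delta1 (n k) (p k) (X k \<omega>) (Y k \<omega>) (beta0 k) (lam0 k) (lam1 k))"
    unfolding small_in_prob_def
  proof (intro allI impI, rule whp_mono[OF whp_good])
    fix d :: real assume d: "0 < d"
    \<comment> \<open>Collects every constant in the bound on \<open>Delta1\<close>, which becomes
      \<open>b * s0 * sqrt (ln p / n)\<close>. The sparsity assumption is then invoked with the
      constant \<open>d / b\<close>.\<close>
    define b where "b = c / Cmin * (12 * a / kmin^2)"
    have b: "0 < b" using c Cmin a kmin by (simp add: b_def)
    have "\<forall>\<^sub>F k in sequentially. real (s0 k) \<le> d / b * sqrt (real (n k) / ln (real (p k)))"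
    proof -
      have "0 \<le> sqrt (real (n k) / ln (real (p k)))" for k
        using p0[of k] by simp
      then show ?thesis
        using landau_o.smallD[OF sparsity, of "d / b"] d b by simp
    qed
    then show "\<forall>\<^sub>F k in sequentially. \<forall>\<omega>\<in>space (M k). good k \<omega> \<longrightarrow>
        \<bar>Delta1 (n k) (p k) (X k \<omega>) (Y k \<omega>) (beta0 k) (lam0 k) (lam1 k)\<bar> \<le> d"
      using ev_n[of 1]
    proof eventually_elim
      case (elim k)
      then have nk: "0 < n k" by simp
      let ?q = "sqrt (ln (real (p k)) / real (n k))"
      have q: "0 < ?q" "sqrt (real (n k) / ln (real (p k))) = 1 / ?q"
        using nk lnp[OF nk] by (simp_all add: real_sqrt_divide)
      have sq: "real (s0 k) * ?q \<le> d / b"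
      proof -
        have "x * y \<le> z" if "0 < y" "x \<le> z * (1 / y)" for x y z :: real
          using that by (simp add: field_simps)
        from this[OF q(1) elim(1)[unfolded q(2)]] show ?thesis .
      qed
      show ?case
      proof (intro ballI impI)
        fix \<omega> assume g: "good k \<omega>"
        let ?tau = "tau_hat_sq (n k) (p k) (X k \<omega>) (lam1 k)"
        have tau: "Cmin \<le> ?tau"
          using g tau_tilde_sq_le_tau_hat_sq[of "lam1 k" "n k" "p k" "X k \<omega>"] lam1_pos[OF nk]
          by (simp add: good_def)
        then have tau0: "0 < ?tau" using Cmin by simp
        have "sqrt (real (n k)) * lam1 k = c" using nk by (simp add: lam1_def)
        with Delta1_bound[OF lam1_pos[OF nk] tau0, of "Y k \<omega>" "beta0 k" "lam0 k"]
        have "\<bar>Delta1 (n k) (p k) (X k \<omega>) (Y k \<omega>) (beta0 k) (lam0 k) (lam1 k)\<bar>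
            \<le> c / ?tau * (\<Sum>j<p k. \<bar>lasso (n k) (p k) (X k \<omega>) (Y k \<omega>) (lam0 k) j - beta0 k j\<bar>)"
          by simp
        also have "\<dots> \<le> c / Cmin * (12 * lam0 k * real (s0 k) / kmin^2)"
        proof (rule mult_mono)
          show "c / ?tau \<le> c / Cmin" using c Cmin tau by (intro divide_left_mono) auto
          show "(\<Sum>j<p k. \<bar>lasso (n k) (p k) (X k \<omega>) (Y k \<omega>) (lam0 k) j - beta0 k j\<bar>)
              \<le> 12 * lam0 k * real (s0 k) / kmin^2"
            using g by (simp add: good_def)
        qed (use c Cmin in \<open>auto intro!: sum_nonneg\<close>)
        also have "\<dots> = b * (real (s0 k) * ?q)" by (simp add: b_def lam0_def)
        also have "\<dots> \<le> b * (d / b)" using sq b by (intro mult_left_mono) auto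
        also have "\<dots> = d" using b by simp
        finally show "\<bar>Delta1 (n k) (p k) (X k \<omega>) (Y k \<omega>) (beta0 k) (lam0 k) (lam1 k)\<bar> \<le> d" .
      qed
    qed
  qed

  have law: "measure (completion (M k))
      {\<omega>\<in>space (M k). X k \<omega> \<in> Bx \<and> W1 (n k) (p k) (X k \<omega>) (eps k \<omega>) (lam1 k) \<in> A}
    = (\<integral>\<omega>. indicator Bx (X k \<omega>) * measure (normal_law (sigma^2 * Omega_hat (n k) (p k) (X k \<omega>) (lam1 k))) A
       \<partial>completion (M k))" if A: "A \<in> sets borel" and Bx: "Bx \<in> sets matM" for k A Bx
  proof -
    interpret gaussian_noise "M k" "n k" "X k" "eps k" sigma by (rule gn)
    define u where "u i x = mv (p k) x (Theta_hat (n k) (p k) x (lam1 k)) i / sqrt (real (n k))" for i x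
    \<comment> \<open>An index \<open>i < n k\<close> forces \<open>0 < n k\<close>, hence
      \<open>0 < lam1 k\<close>; for \<open>n k = 0\<close> there is no coefficient to
      consider.\<close>
    have u: "u i \<in> borel_measurable matM" if "i < n k" for i
      unfolding u_def
      using that lam1_pos[of k] p0[of k]
      by (intro borel_measurable_divide Theta_hat_fit_measurable borel_measurable_const) auto
    have W: "W1 (n k) (p k) (X k \<omega>) (eps k \<omega>) (lam1 k) = (\<Sum>i<n k. u i (X k \<omega>) * eps k \<omega> i)" for \<omega>
      by (simp add: W1_eq u_def)
    have Om: "Omega_hat (n k) (p k) x (lam1 k) = (\<Sum>i<n k. (u i x)^2)" for x
      by (simp add: Omega_hat_eq sqn_def u_def power_divide sum_divide_distrib)
    note [measurable] = linear_form_measurable[OF u A] A Bx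
    have "{\<omega>\<in>space (M k). X k \<omega> \<in> Bx \<and> (\<Sum>i<n k. u i (X k \<omega>) * eps k \<omega> i) \<in> A} \<in> sets (M k)"
      by measurable
    \<comment> \<open>The event and the integrand are measurable for \<open>M k\<close> itself, so
      passing to the completion changes neither side.\<close>
    then show ?thesis
      unfolding W Om
      by (subst measure_completion, simp)
        (subst integral_completion, rule law_at_integrable(1)[OF u A Bx], assumption,
          rule conditional_normal_law[OF u A Bx], assumption)
  qed

  show ?thesis
  proof (rule exI[of _ lam0], rule exI[of _ lam1], intro conjI)
    show "\<exists>c1 c2. 0 < c1 \<and> c1 \<le> c2 \<and> (\<forall>\<^sub>F k in sequentially.
        c1 \<le> lam0 k / sqrt (ln (real (p k)) / real (n k)) \<and>
        lam0 k / sqrt (ln (real (p k)) / real (n k)) \<le> c2)"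
    proof (intro exI[of _ a] conjI)
      show "\<forall>\<^sub>F k in sequentially. a \<le> lam0 k / sqrt (ln (real (p k)) / real (n k)) \<and>
          lam0 k / sqrt (ln (real (p k)) / real (n k)) \<le> a"
        using ev_n[of 1]
      proof eventually_elim
        case (elim k)
        then show ?case using lnp[of k] by (simp add: lam0_def)
      qed
    qed (use a in auto)
    show "\<exists>c1 c2. 0 < c1 \<and> c1 \<le> c2 \<and> (\<forall>\<^sub>F k in sequentially.
        c1 \<le> lam1 k / (1 / sqrt (real (n k))) \<and> lam1 k / (1 / sqrt (real (n k))) \<le> c2)"
    proof (intro exI[of _ c] conjI)
      show "\<forall>\<^sub>F k in sequentially. c \<le> lam1 k / (1 / sqrt (real (n k))) \<and> lam1 k / (1 / sqrt (real (n k))) \<le> c"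
        using ev_n[of 1] by eventually_elim (simp add: lam1_def)
    qed (use c in auto)
    show "\<forall>k. \<forall>\<omega>\<in>space (M k).
        sqrt (real (n k)) * (debiased1 (n k) (p k) (X k \<omega>) (Y k \<omega>) (lam0 k) (lam1 k) - beta0 k 0)
        = W1 (n k) (p k) (X k \<omega>) (eps k \<omega>) (lam1 k)
          + Delta1 (n k) (p k) (X k \<omega>) (Y k \<omega>) (beta0 k) (lam0 k) (lam1 k)"
      by (intro allI ballI debiased_decomposition p0) (simp add: Y_def)
  qed (use law bounded small in blast)+
qed

end
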